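(* A center function $f$ is concurrent for every admissible transversal (of every triangle $ABC$) if and only if its shape function factors as $$F(\alpha,\beta,\gamma)=\phi(\alpha)\,M(\alpha,\beta,\gamma),$$ where $M$ is fully symmetric and $\phi$ is odd about $\pi/2$. Equivalently, the leg-swap ratio has the form $$Q(\alpha,\beta,\gamma)=\frac{\phi(\beta)}{\phi(\alpha)},$$ where $\phi$ is odd about $\pi/2$.
   Context: An admissible transversal of $\triangle ABC$ is a line $\ell$ that passes through no vertex and is parallel to no side; it meets the sidelines $BC,CA,AB$ at $D,E,F$ respectively. A (barycentric) center function is a real function $f(x,y,z)$ of side lengths, homogeneous and symmetric in its last two arguments; for a triangle $P_1P_2P_3$ whose sides opposite $P_1,P_2,P_3$ have lengths $\lambda_1,\lambda_2,\lambda_3$, its $X$-point is the point with homogeneous barycentric coordinates $(f(\lambda_1,\lambda_2,\lambda_3):f(\lambda_2,\lambda_3,\lambda_1):f(\lambda_3,\lambda_1,\lambda_2))$ relative to $P_1P_2P_3$. With $G,H,I$ the $X$-points of triangles $AEF$, $BFD$, $CDE$, the center $X$ (or its center function $f$) is called concurrent for $\ell$ if the lines $AG,BH,CI$ are concurrent (three parallel lines count as concurrent; it is tacitly understood that the points and lines are defined). A shape is an ordered triple $(\alpha,\beta,\gamma)$ with $0<\alpha,\beta,\gamma<\pi$ and $\alpha+\beta+\gamma=\pi$. The shape function of $f$ is $F(\alpha,\beta,\gamma)=f(\sin\alpha,\sin\beta,\sin\gamma)$, so $F(\alpha,\beta,\gamma)=F(\alpha,\gamma,\beta)$. The leg-swap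 ratio is $Q(\alpha,\beta,\gamma)=F(\beta,\alpha,\gamma)/F(\alpha,\beta,\gamma)$ (where the denominator is nonzero). A function $M(\alpha,\beta,\gamma)$ is fully symmetric if it is unchanged by every permutation of $\alpha,\beta,\gamma$. A function $\phi$ on $(0,\pi)$ is odd about $\pi/2$ if $\phi(\pi-t)=-\phi(t)$ for all $t\in(0,\pi)$.
   Formalization: Assumes all points and lines are defined for every triangle and transversal, and, since concurrency need not imply factorization for irregular f, that nonvanishing of f persists under small changes of the triangle, away from a right angle opposite the first side. *)

theory Defs
  imports "HOL-Analysis.Analysis"
begin

section \<open>Center functions\<close>

text \<open>Side lengths of a nondegenerate triangle; positivity follows from the three inequalities.
  A center function is a total function, but only its values at such triples matter.\<close>

definition triangle_sides :: "real \<Rightarrow> real \<Rightarrow> real \<Rightarrow> bool" where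
  "triangle_sides x y z \<longleftrightarrow> x < y + z \<and> y < z + x \<and> z < x + y"

definition center_function :: "(real \<Rightarrow> real \<Rightarrow> real \<Rightarrow> real) \<Rightarrow> bool" where
  "center_function f \<longleftrightarrow>
     (\<exists>n::real. \<forall>t x y z. t > 0 \<and> triangle_sides x y z \<longrightarrow>
        f (t * x) (t * y) (t * z) = t powr n * f x y z) \<and>
     (\<forall>x y z. triangle_sides x y z \<longrightarrow> f x y z = f x z y)"

section \<open>Shapes\<close>

definition shape :: "real \<Rightarrow> real \<Rightarrow> real \<Rightarrow> bool" where
  "shape \<alpha> \<beta> \<gamma> \<longleftrightarrow>
     0 < \<alpha> \<and> \<alpha> < pi \<and> 0 < \<beta> \<and> \<beta> < pi \<and> 0 < \<gamma> \<and> \<gamma> < pi \<and> \<alpha> + \<beta> + \<gamma> = pi"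

definition shape_function ::
  "(real \<Rightarrow> real \<Rightarrow> real \<Rightarrow> real) \<Rightarrow> real \<Rightarrow> real \<Rightarrow> real \<Rightarrow> real" where
  "shape_function f \<alpha> \<beta> \<gamma> = f (sin \<alpha>) (sin \<beta>) (sin \<gamma>)"

definition leg_swap_ratio ::
  "(real \<Rightarrow> real \<Rightarrow> real \<Rightarrow> real) \<Rightarrow> real \<Rightarrow> real \<Rightarrow> real \<Rightarrow> real" where
  "leg_swap_ratio f \<alpha> \<beta> \<gamma> = shape_function f \<beta> \<alpha> \<gamma> / shape_function f \<alpha> \<beta> \<gamma>"

definition fully_symmetric :: "(real \<Rightarrow> real \<Rightarrow> real \<Rightarrow> real) \<Rightarrow> bool" where
  "fully_symmetric M \<longleftrightarrow> (\<forall>\<alpha> \<beta> \<gamma>. shape \<alpha> \<beta> \<gamma> \<longrightarrow>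
     M \<alpha> \<gamma> \<beta> = M \<alpha> \<beta> \<gamma> \<and> M \<beta> \<alpha> \<gamma> = M \<alpha> \<beta> \<gamma> \<and> M \<beta> \<gamma> \<alpha> = M \<alpha> \<beta> \<gamma> \<and>
     M \<gamma> \<alpha> \<beta> = M \<alpha> \<beta> \<gamma> \<and> M \<gamma> \<beta> \<alpha> = M \<alpha> \<beta> \<gamma>)"

definition odd_about_half_pi :: "(real \<Rightarrow> real) \<Rightarrow> bool" where
  "odd_about_half_pi \<phi> \<longleftrightarrow> (\<forall>t. 0 < t \<and> t < pi \<longrightarrow> \<phi> (pi - t) = - \<phi> t)"

section \<open>Points and lines\<close>

text \<open>Points and lines of the projective plane are given by nonzero homogeneous coordinate
  vectors; a zero vector means that the point or line is undefined. Thus a point whose barycentric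
  coordinates sum to zero is a point at infinity, and parallel lines meet in one.\<close>

definition homog :: "real^2 \<Rightarrow> real^3" where
  "homog P = vector [P $ 1, P $ 2, 1]"

definition X_point ::
  "(real \<Rightarrow> real \<Rightarrow> real \<Rightarrow> real) \<Rightarrow> real^2 \<Rightarrow> real^2 \<Rightarrow> real^2 \<Rightarrow> real^3" where
  "X_point f P1 P2 P3 =
     (let l1 = dist P2 P3; l2 = dist P3 P1; l3 = dist P1 P2
      in f l1 l2 l3 *\<^sub>R homog P1 + f l2 l3 l1 *\<^sub>R homog P2 + f l3 l1 l2 *\<^sub>R homog P3)"

definition line_to_X ::
  "(real \<Rightarrow> real \<Rightarrow> real \<Rightarrow> real) \<Rightarrow> real^2 \<Rightarrow> real^2 \<Rightarrow> real^2 \<Rightarrow> real^3" where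
  "line_to_X f P1 P2 P3 = cross3 (homog P1) (X_point f P1 P2 P3)"

definition concurrent_lines :: "real^3 \<Rightarrow> real^3 \<Rightarrow> real^3 \<Rightarrow> bool" where
  "concurrent_lines l m n \<longleftrightarrow> (\<exists>p. p \<noteq> 0 \<and> l \<bullet> p = 0 \<and> m \<bullet> p = 0 \<and> n \<bullet> p = 0)"

section \<open>Transversals\<close>

definition admissible_transversal :: "real^2 \<Rightarrow> real^2 \<Rightarrow> real^2 \<Rightarrow> (real^2) set \<Rightarrow> bool" where
  "admissible_transversal A B C l \<longleftrightarrow>
     affine l \<and> aff_dim l = 1 \<and> A \<notin> l \<and> B \<notin> l \<and> C \<notin> l \<and>
     \<not> affine_parallel l (affine hull {B, C}) \<and>
     \<not> affine_parallel l (affine hull {C, A}) \<and>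
     \<not> affine_parallel l (affine hull {A, B})"

definition meets_sidelines ::
  "real^2 \<Rightarrow> real^2 \<Rightarrow> real^2 \<Rightarrow> (real^2) set \<Rightarrow> real^2 \<Rightarrow> real^2 \<Rightarrow> real^2 \<Rightarrow> bool" where
  "meets_sidelines A B C l D E F \<longleftrightarrow>
     l \<inter> affine hull {B, C} = {D} \<and> l \<inter> affine hull {C, A} = {E} \<and> l \<inter> affine hull {A, B} = {F}"

text \<open>The points \<open>G, H, I\<close> and the lines \<open>AG, BH, CI\<close> exist.\<close>

definition centers_defined ::
  "(real \<Rightarrow> real \<Rightarrow> real \<Rightarrow> real) \<Rightarrow> real^2 \<Rightarrow> real^2 \<Rightarrow> real^2 \<Rightarrow> (real^2) set \<Rightarrow> bool" where
  "centers_defined f A B C l \<longleftrightarrow> (\<exists>D E F. meets_sidelines A B C l D E F \<and>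
     X_point f A E F \<noteq> 0 \<and> X_point f B F D \<noteq> 0 \<and> X_point f C D E \<noteq> 0 \<and>
     line_to_X f A E F \<noteq> 0 \<and> line_to_X f B F D \<noteq> 0 \<and> line_to_X f C D E \<noteq> 0)"

definition concurrent_for ::
  "(real \<Rightarrow> real \<Rightarrow> real \<Rightarrow> real) \<Rightarrow> real^2 \<Rightarrow> real^2 \<Rightarrow> real^2 \<Rightarrow> (real^2) set \<Rightarrow> bool" where
  "concurrent_for f A B C l \<longleftrightarrow> centers_defined f A B C l \<and>
     (\<exists>D E F. meets_sidelines A B C l D E F \<and>
        concurrent_lines (line_to_X f A E F) (line_to_X f B F D) (line_to_X f C D E))"

section \<open>Standing assumptions\<close>

definition always_defined :: "(real \<Rightarrow> real \<Rightarrow> real \<Rightarrow> real) \<Rightarrow> bool" where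
  "always_defined f \<longleftrightarrow> (\<forall>A B C l. \<not> collinear {A, B, C} \<and> admissible_transversal A B C l \<longrightarrow>
     centers_defined f A B C l)"

text \<open>Nonvanishing of \<open>f\<close> persists under small changes of the triangle, except that nothing is
  required at triangles with a right angle opposite the first side. This holds if \<open>f\<close> is continuous
  at all other triangles, and also if \<open>f\<close>, continuous or not, has no zero at any of them.

  Some such condition is needed to pass from concurrency to a factorization: put
  \<open>F(\<alpha>,\<beta>,\<gamma>) = 0\<close> if \<open>\<alpha>\<close> is a multiple of \<open>\<pi>/4\<close> and \<open>F(\<alpha>,\<beta>,\<gamma>) = cos \<alpha>\<close> otherwise, except that
  \<open>F = 1\<close> at \<open>(\<pi>/4, \<pi>/4, \<pi>/2)\<close> and \<open>(\<pi>/4, \<pi>/2, \<pi>/4)\<close>. All points and lines are defined and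
  all three cevians concur for every transversal (in each triangle the weights are, up to scaling,
  limits for \<open>t \<rightarrow> 0\<close> of those for \<open>\<phi>\<^sub>t = t cos\<close> on multiples of \<open>\<pi>/4\<close> and \<open>\<phi>\<^sub>t = cos\<close> elsewhere), but
  \<open>F = \<phi> M\<close> would force both \<open>\<phi>(\<pi>/4) = 0\<close> and \<open>\<phi>(\<pi>/4) \<noteq> 0\<close>.\<close>

definition stably_nonzero :: "(real \<Rightarrow> real \<Rightarrow> real \<Rightarrow> real) \<Rightarrow> bool" where
  "stably_nonzero f \<longleftrightarrow>
     open {(x, y, z). triangle_sides x y z \<and> x\<^sup>2 \<noteq> y\<^sup>2 + z\<^sup>2 \<and> f x y z \<noteq> 0}"

end

theory Submission
  imports Defs
begin

text \<open>
  Write \<open>F\<close> for the shape function. The determinant form of Ceva's theorem, combined with the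
  Menelaus relation for \<open>D, E, F\<close>, turns concurrency of the three lines into a relation between
  the weights of the centers at the points of the transversal (\<open>concurrent_iff_weights\<close>): the product
  of the weights of \<open>E\<close> in \<open>AEF\<close>, \<open>F\<close> in \<open>BFD\<close>, \<open>D\<close> in \<open>CDE\<close> is the negative of the product of the
  weights of \<open>F\<close> in \<open>AEF\<close>, \<open>D\<close> in \<open>BFD\<close>, \<open>E\<close> in \<open>CDE\<close>. At each of \<open>D, E, F\<close> the two triangles have
  equal or supplementary angles, and supplementary ones occur an odd number of times. So
  if \<open>F(\<alpha>,\<beta>,\<gamma>) = \<phi>(\<alpha>) M(\<alpha>,\<beta>,\<gamma>)\<close> with \<open>\<phi>\<close> odd about \<open>\<pi>/2\<close>, the factors \<open>M\<close> cancel and the values of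
  \<open>\<phi>\<close> differ by an odd number of signs (\<open>concurrent_if_factorization\<close>).

  For the converse, the shape of a triangle depends only on the directions of its sides. If three
  lines have direction angles \<open>i, j, k\<close>, the weight of the vertex on the first two is, up to scaling,
  \<open>w i j k = f \<bar>sin (i - j)\<bar> \<bar>sin (j - k)\<bar> \<bar>sin (k - i)\<bar>\<close>. Every four pairwise distinct directions
  occur for some triangle and transversal (\<open>transversal_with_directions\<close>), so concurrency says that
  \<open>r(x, y) = - w 0 x y / w 0 y x\<close> is a cocycle, \<open>r(x, y) r(y, z) r(z, x) = 1\<close>, as long as no weight
  vanishes. With a base direction \<open>q\<close> and \<open>\<phi>(x) = r(x, q)\<close> this gives \<open>r(x, y) = \<phi>(x) / \<phi>(y)\<close>, which is
  the leg-swap formula for the shape with angles \<open>x\<close> and \<open>\<pi> - y\<close>; reflection gives \<open>r(x, -x) = -1\<close>,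
  which is oddness.

  Zero weights are the main difficulty: \<open>\<phi>\<close> is a well-defined odd function with
  the right zeros only if the vanishing of \<open>w i j k\<close> does not depend on \<open>k\<close> (\<open>vanishes_persists\<close>).
  Since the lines \<open>AG, BH, CI\<close> exist, no triangle has two zero weights; together with the cocycle
  relation this makes ``\<open>x = y\<close> or \<open>w x y k = 0\<close>'' transitive in \<open>x, y\<close> for each fixed \<open>k\<close>. A class of
  this relation containing an interval would, by
  stability of nonvanishing, reach an isosceles triangle with two zero weights. But if \<open>w i j k = 0\<close>
  and \<open>w i j l \<noteq> 0\<close>, then all directions near \<open>l\<close> are in the class of \<open>i\<close>. An isosceles triangle also
  shows that \<open>q = \<pi>/4\<close> never has weight zero, so it can serve as base direction.
\<close>

section \<open>Ceva and Menelaus for the cevians through the centers\<close>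

text \<open>Twice the signed area of the triangle \<open>PQR\<close>.\<close>

definition area2 :: "real^2 \<Rightarrow> real^2 \<Rightarrow> real^2 \<Rightarrow> real" where
  "area2 P Q R = (Q$1 - P$1) * (R$2 - P$2) - (R$1 - P$1) * (Q$2 - P$2)"

lemma collinear_iff_area2: "collinear {P, Q, R} \<longleftrightarrow> area2 P Q R = 0"
proof
  assume "collinear {P, Q, R}"
  then consider "P = R" | u where "Q = u *\<^sub>R P + (1 - u) *\<^sub>R R"
    unfolding collinear_3_expand by blast
  then show "area2 P Q R = 0"
  proof cases
    case (2 u)
    show ?thesis
      unfolding area2_def 2 by (simp add: algebra_simps)
  qed (simp add: area2_def)
next
  assume 0: "area2 P Q R = 0"
  show "collinear {P, Q, R}"
  proof (cases "P = R")
    case False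
    then consider "R$1 \<noteq> P$1" | "R$2 \<noteq> P$2"
      by (metis (full_types) exhaust_2 vec_eq_iff)
    then obtain v where "Q$1 - P$1 = v * (R$1 - P$1)" "Q$2 - P$2 = v * (R$2 - P$2)"
    proof cases
      case 1
      then show thesis
        using that[of "(Q$1 - P$1) / (R$1 - P$1)"] 0 by (simp add: area2_def field_simps)
    next
      case 2
      then show thesis
        using that[of "(Q$2 - P$2) / (R$2 - P$2)"] 0 by (simp add: area2_def field_simps)
    qed
    then have "Q = (1 - v) *\<^sub>R P + (1 - (1 - v)) *\<^sub>R R"
      unfolding vec_eq_iff forall_2 by (simp add: algebra_simps)
    then show ?thesis
      unfolding collinear_3_expand by blast
  qed (simp add: collinear_3_expand)
qed

lemma concurrent_lines_iff_det:
  "concurrent_lines l m n \<longleftrightarrow> det (vector [l, m, n] :: real^3^3) = 0"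
proof -
  let ?A = "vector [l, m, n] :: real^3^3"
  have mult: "?A *v p = 0 \<longleftrightarrow> l \<bullet> p = 0 \<and> m \<bullet> p = 0 \<and> n \<bullet> p = 0" for p
    by (simp add: vec_eq_iff forall_3 matrix_vector_mul_component)
  have "det ?A \<noteq> 0 \<longleftrightarrow> (\<forall>p. ?A *v p = 0 \<longrightarrow> p = 0)"
    by (metis invertible_det_nz invertible_left_inverse matrix_left_invertible_ker)
  then show ?thesis
    unfolding concurrent_lines_def mult by blast
qed

text \<open>Ceva's theorem in determinant form: the rows are the lines joining \<open>a, b, c\<close> to points of the
  opposite sides.\<close>

lemma det_cevians:
  fixes a b c :: "real^3"
  shows "det (vector [cross3 a (p1 *\<^sub>R c + q1 *\<^sub>R b), cross3 b (p2 *\<^sub>R a + q2 *\<^sub>R c),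
                      cross3 c (p3 *\<^sub>R b + q3 *\<^sub>R a)] :: real^3^3) =
         (q1 * q2 * q3 - p1 * p2 * p3) * (det (vector [a, b, c] :: real^3^3))\<^sup>2"
  unfolding det_3 cross3_def vector_3
  by simp algebra

lemma det_homog: "det (vector [homog A, homog B, homog C] :: real^3^3) = area2 A B C"
  by (simp add: det_3 homog_def area2_def algebra_simps)

lemma line_to_X_affine_combinations:
  fixes A B C :: "real^2"
  assumes E: "E = (1 - u) *\<^sub>R C + u *\<^sub>R A" and F: "F = (1 - r) *\<^sub>R A + r *\<^sub>R B"
  shows "line_to_X f A E F = cross3 (homog A)
    ((f (dist F A) (dist A E) (dist E F) * (1 - u)) *\<^sub>R homog C +
     (f (dist A E) (dist E F) (dist F A) * r) *\<^sub>R homog B)"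
proof -
  have "cross3 (homog A) (x *\<^sub>R homog A + y *\<^sub>R homog E + z *\<^sub>R homog F) =
      cross3 (homog A) ((y * (1 - u)) *\<^sub>R homog C + (z * r) *\<^sub>R homog B)" for x y z
    unfolding E F vec_eq_iff forall_3 cross3_def homog_def
    by (simp add: algebra_simps)
  then show ?thesis
    by (simp add: line_to_X_def X_point_def Let_def)
qed

text \<open>The equation for \<open>r, t, u\<close> is Menelaus' theorem.\<close>

lemma meets_sidelines_points:
  assumes tri: "\<not> collinear {A, B, C}" and adm: "admissible_transversal A B C l"
    and meets: "meets_sidelines A B C l D E F"
  obtains t u r where
    "D = (1 - t) *\<^sub>R B + t *\<^sub>R C" "E = (1 - u) *\<^sub>R C + u *\<^sub>R A" "F = (1 - r) *\<^sub>R A + r *\<^sub>R B"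
    "r * t * u + (1 - r) * (1 - t) * (1 - u) = 0"
    "r \<noteq> 0" "r \<noteq> 1" "t \<noteq> 0" "t \<noteq> 1" "u \<noteq> 0" "u \<noteq> 1"
proof -
  have on: "D \<in> l" "E \<in> l" "F \<in> l" and off: "A \<notin> l" "B \<notin> l" "C \<notin> l"
    and hull: "D \<in> affine hull {B, C}" "E \<in> affine hull {C, A}" "F \<in> affine hull {A, B}"
    using meets adm unfolding meets_sidelines_def admissible_transversal_def by auto
  have point: "\<exists>t. P = (1 - t) *\<^sub>R Q + t *\<^sub>R R" if P: "P \<in> affine hull {Q, R}" for P Q R :: "real^2"
  proof -
    obtain x y where "P = x *\<^sub>R Q + y *\<^sub>R R" "x + y = 1"
      using P unfolding affine_hull_2 by blast
    then have "P = (1 - y) *\<^sub>R Q + y *\<^sub>R R"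
      by (simp add: eq_diff_eq)
    then show ?thesis ..
  qed
  obtain t u r where
    D: "D = (1 - t) *\<^sub>R B + t *\<^sub>R C" and E: "E = (1 - u) *\<^sub>R C + u *\<^sub>R A" and F: "F = (1 - r) *\<^sub>R A + r *\<^sub>R B"
    using hull[THEN point] by metis
  have "collinear l"
    using adm unfolding admissible_transversal_def collinear_aff_dim by simp
  then have "collinear {D, E, F}"
    using on by (auto intro: collinear_subset)
  then have "area2 D E F = 0"
    by (simp add: collinear_iff_area2)
  moreover have "area2 D E F = (r * t * u + (1 - r) * (1 - t) * (1 - u)) * area2 A B C"
    unfolding D E F area2_def by simp algebra
  ultimately have "r * t * u + (1 - r) * (1 - t) * (1 - u) = 0"
    using tri by (simp add: collinear_iff_area2)
  moreover have "r \<noteq> 0" "r \<noteq> 1" "t \<noteq> 0" "t \<noteq> 1" "u \<noteq> 0" "u \<noteq> 1"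
    using on off D E F by auto
  ultimately show thesis
    using that D E F by blast
qed

text \<open>The two products run over the corners \<open>A, B, C\<close>; in the first the point of the transversal on
  the side preceding each corner is weighted (\<open>E\<close> at \<open>A\<close>, \<open>F\<close> at \<open>B\<close>, \<open>D\<close> at \<open>C\<close>), in the second the other one.\<close>

lemma concurrent_iff_weights:
  assumes tri: "\<not> collinear {A, B, C}" and adm: "admissible_transversal A B C l"
    and meets: "meets_sidelines A B C l D E F"
  shows "concurrent_lines (line_to_X f A E F) (line_to_X f B F D) (line_to_X f C D E) \<longleftrightarrow>
    f (dist F A) (dist A E) (dist E F) * f (dist D B) (dist B F) (dist F D)
      * f (dist E C) (dist C D) (dist D E)
    + f (dist A E) (dist E F) (dist F A) * f (dist B F) (dist F D) (dist D B)
      * f (dist C D) (dist D E) (dist E C) = 0"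
  (is "_ \<longleftrightarrow> ?eA * ?fB * ?dC + ?fA * ?dB * ?eC = 0")
proof -
  obtain t u r where
    D: "D = (1 - t) *\<^sub>R B + t *\<^sub>R C" and E: "E = (1 - u) *\<^sub>R C + u *\<^sub>R A" and F: "F = (1 - r) *\<^sub>R A + r *\<^sub>R B"
    and menelaus: "r * t * u + (1 - r) * (1 - t) * (1 - u) = 0"
    and nz: "r \<noteq> 0" "t \<noteq> 0" "u \<noteq> 0"
    using meets_sidelines_points[OF assms] by metis
  have "area2 A B C \<noteq> 0"
    using tri by (simp add: collinear_iff_area2)
  then have "concurrent_lines (line_to_X f A E F) (line_to_X f B F D) (line_to_X f C D E) \<longleftrightarrow>
      (?fA * r) * (?dB * t) * (?eC * u) - (?eA * (1 - u)) * (?fB * (1 - r)) * (?dC * (1 - t)) = 0"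
    unfolding concurrent_lines_iff_det line_to_X_affine_combinations[OF E F]
      line_to_X_affine_combinations[OF F D] line_to_X_affine_combinations[OF D E]
      det_cevians det_homog
    by simp
  also have "\<dots> \<longleftrightarrow> (r * t * u) * (?eA * ?fB * ?dC + ?fA * ?dB * ?eC) = 0"
    using menelaus by algebra
  finally show ?thesis
    using nz by simp
qed

section \<open>Angles and the law of sines\<close>

text \<open>The unoriented angle between two nonzero vectors, in \<open>[0, \<pi>]\<close>.\<close>

definition angle :: "real^2 \<Rightarrow> real^2 \<Rightarrow> real" where
  "angle u v = arccos (u \<bullet> v / (norm u * norm v))"

lemma inner_div_norms_bounds:
  fixes u v :: "real^2"
  assumes "u \<noteq> 0" "v \<noteq> 0"
  shows "- 1 \<le> u \<bullet> v / (norm u * norm v)" "u \<bullet> v / (norm u * norm v) \<le> 1"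
proof -
  have "\<bar>u \<bullet> v / (norm u * norm v)\<bar> \<le> 1"
    using Cauchy_Schwarz_ineq2[of u v] assms by simp
  then show "- 1 \<le> u \<bullet> v / (norm u * norm v)" "u \<bullet> v / (norm u * norm v) \<le> 1"
    by linarith+
qed

lemma angle_scaleR:
  assumes "u \<noteq> 0" "v \<noteq> 0" "a \<noteq> 0" "b \<noteq> 0"
  shows "angle (a *\<^sub>R u) (b *\<^sub>R v) = (if a * b > 0 then angle u v else pi - angle u v)"
proof -
  have "(a *\<^sub>R u) \<bullet> (b *\<^sub>R v) / (norm (a *\<^sub>R u) * norm (b *\<^sub>R v)) =
      (a * b / \<bar>a * b\<bar>) * (u \<bullet> v / (norm u * norm v))"
    by (simp add: abs_mult mult_ac)
  then show ?thesis
    using assms inner_div_norms_bounds[OF assms(1,2)]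
    by (auto simp: angle_def arccos_minus zero_less_mult_iff not_less mult_le_0_iff abs_mult
        simp flip: minus_divide_left)
qed

lemma angle_commute: "angle u v = angle v u"
  by (simp add: angle_def inner_commute mult.commute)

lemma cos_angle: "u \<noteq> 0 \<Longrightarrow> v \<noteq> 0 \<Longrightarrow> cos (angle u v) = u \<bullet> v / (norm u * norm v)"
  unfolding angle_def using inner_div_norms_bounds by (simp add: cos_arccos)

lemma inner_real2: "(u::real^2) \<bullet> v = u$1 * v$1 + u$2 * v$2"
  by (simp add: inner_vec_def sum_2)

lemma norm_real2_squared: "(norm (u::real^2))\<^sup>2 = (u$1)\<^sup>2 + (u$2)\<^sup>2"
  unfolding power2_norm_eq_inner inner_real2 by (simp add: power2_eq_square)

lemma sin_angle:
  assumes "Q \<noteq> P" "R \<noteq> P"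
  shows "sin (angle (Q - P) (R - P)) = \<bar>area2 P Q R\<bar> / (dist P Q * dist P R)"
proof -
  define n where "n = norm (Q - P) * norm (R - P)"
  have n: "n > 0"
    using assms by (simp add: n_def)
  have "((Q - P) \<bullet> (R - P))\<^sup>2 + (area2 P Q R)\<^sup>2 = n\<^sup>2"
    unfolding n_def power_mult_distrib norm_real2_squared inner_real2 area2_def by simp algebra
  then have "1 - ((Q - P) \<bullet> (R - P) / n)\<^sup>2 = (\<bar>area2 P Q R\<bar> / n)\<^sup>2"
    using n by (simp add: field_simps)
  then have "sin (angle (Q - P) (R - P)) = \<bar>area2 P Q R\<bar> / n"
    using inner_div_norms_bounds[of "Q - P" "R - P"] assms n
    unfolding angle_def n_def
    by (simp add: sin_arccos)
  then show ?thesis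
    unfolding n_def dist_norm[symmetric] by (simp only: dist_commute)
qed

lemma angle_strict_bounds:
  assumes "area2 P Q R \<noteq> 0"
  shows "0 < angle (Q - P) (R - P)" "angle (Q - P) (R - P) < pi"
proof -
  have ne: "Q \<noteq> P" "R \<noteq> P"
    using assms by (auto simp: area2_def)
  then have "sin (angle (Q - P) (R - P)) > 0"
    using assms by (simp add: sin_angle)
  moreover have "0 \<le> angle (Q - P) (R - P)" "angle (Q - P) (R - P) \<le> pi"
    unfolding angle_def using inner_div_norms_bounds[of "Q - P" "R - P"] ne
    by (auto intro: arccos_lbound arccos_ubound)
  ultimately show "0 < angle (Q - P) (R - P)" "angle (Q - P) (R - P) < pi"
    by (metis less_eq_real_def less_irrefl sin_zero sin_pi)+
qed

lemma area2_rotate: "area2 Q R P = area2 P Q R"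
  by (simp add: area2_def algebra_simps)

lemma angle_sum:
  assumes "area2 P Q R \<noteq> 0"
  shows "angle (Q - P) (R - P) + angle (R - Q) (P - Q) + angle (P - R) (Q - R) = pi"
proof -
  let ?a = "dist Q R" and ?b = "dist R P" and ?c = "dist P Q" and ?K = "\<bar>area2 P Q R\<bar>"
  let ?A = "angle (Q - P) (R - P)" and ?B = "angle (R - Q) (P - Q)" and ?C = "angle (P - R) (Q - R)"
  have ne: "P \<noteq> Q" "Q \<noteq> R" "R \<noteq> P"
    using assms by (auto simp: area2_def)
  then have pos: "?a > 0" "?b > 0" "?c > 0" by simp_all
  have sq: "?a\<^sup>2 = (Q$1 - R$1)\<^sup>2 + (Q$2 - R$2)\<^sup>2" "?b\<^sup>2 = (R$1 - P$1)\<^sup>2 + (R$2 - P$2)\<^sup>2"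
    "?c\<^sup>2 = (P$1 - Q$1)\<^sup>2 + (P$2 - Q$2)\<^sup>2"
    by (simp_all add: dist_norm norm_real2_squared)
  have s: "sin ?A = ?K / (?b * ?c)" "sin ?B = ?K / (?c * ?a)" "sin ?C = ?K / (?a * ?b)"
    using ne sin_angle[of Q P R] sin_angle[of R Q P] sin_angle[of P R Q]
    by (simp_all add: area2_rotate[of Q R P] area2_rotate[of P Q R] dist_commute mult.commute)
  have c: "cos ?A = (Q - P) \<bullet> (R - P) / (?b * ?c)" "cos ?B = (R - Q) \<bullet> (P - Q) / (?c * ?a)"
    "cos ?C = (P - R) \<bullet> (Q - R) / (?a * ?b)"
    using ne cos_angle[of "Q - P" "R - P"] cos_angle[of "R - Q" "P - Q"] cos_angle[of "P - R" "Q - R"]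
    by (simp_all add: dist_norm norm_minus_commute mult.commute)
  have sin_sum: "K / (b * c) * (y / (c * a)) + x / (b * c) * (K / (c * a)) = K / (a * b)"
    if "x + y = c\<^sup>2" "a > 0" "b > 0" "c > 0" for K a b c x y :: real
  proof -
    have "K / (b * c) * (y / (c * a)) + x / (b * c) * (K / (c * a)) = K * (x + y) / (a * b * c\<^sup>2)"
      using that(2-4) by (simp add: field_simps power2_eq_square)
    then show ?thesis
      using that by simp
  qed
  have proj: "(Q - P) \<bullet> (R - P) + (R - Q) \<bullet> (P - Q) = ?c\<^sup>2"
    unfolding sq inner_real2 by (simp add: algebra_simps power2_eq_square)
  have "sin (?A + ?B) = sin ?C"
    unfolding sin_add s c by (rule sin_sum[OF proj pos])
  have cos_sum: "x / (b * c) * (y / (c * a)) - \<bar>K\<bar> / (b * c) * (\<bar>K\<bar> / (c * a)) = - (z / (a * b))"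
    if "x * y - K\<^sup>2 = - z * c\<^sup>2" "a > 0" "b > 0" "c > 0" for K a b c x y z :: real
  proof -
    have "x / (b * c) * (y / (c * a)) - \<bar>K\<bar> / (b * c) * (\<bar>K\<bar> / (c * a)) = (x * y - K\<^sup>2) / (a * b * c\<^sup>2)"
      using that(2-4) by (simp add: field_simps power2_eq_square)
    then show ?thesis
      using that by simp
  qed
  have prod: "((Q - P) \<bullet> (R - P)) * ((R - Q) \<bullet> (P - Q)) - (area2 P Q R)\<^sup>2 = - ((P - R) \<bullet> (Q - R)) * ?c\<^sup>2"
    unfolding sq inner_real2 area2_def by simp algebra
  have cos: "cos (?A + ?B) = - cos ?C"
    unfolding cos_add s c by (rule cos_sum[OF prod pos])
  have A: "0 < ?A" "?A < pi"
    by (rule angle_strict_bounds[OF assms])+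
  have B: "0 < ?B" "?B < pi"
    by (rule angle_strict_bounds; use assms area2_rotate[of Q R P] in simp)+
  have C: "0 < ?C" "?C < pi"
    by (rule angle_strict_bounds; use assms area2_rotate[of P Q R] in simp)+
  have "\<not> pi \<le> ?A + ?B"
  proof
    assume "pi \<le> ?A + ?B"
    then have "sin (?A + ?B) \<le> 0"
      by (intro sin_le_zero) (use A B in linarith)+
    moreover have "sin ?C > 0"
      using C by (rule sin_gt_zero)
    ultimately show False
      using \<open>sin (?A + ?B) = sin ?C\<close> by linarith
  qed
  have "cos (?A + ?B) = cos (pi - ?C)"
    unfolding cos by simp
  then have "?A + ?B = pi - ?C"
    using \<open>\<not> pi \<le> ?A + ?B\<close> A B C cos_inj_pi[of "?A + ?B" "pi - ?C"] by linarith
  then show ?thesis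
    by linarith
qed

text \<open>The law of sines, with \<open>k\<close> the diameter of the circumscribed circle.\<close>

lemma triangle_shape:
  assumes "area2 P Q R \<noteq> 0"
  obtains k \<alpha> \<beta> \<gamma> where "k > 0" "shape \<alpha> \<beta> \<gamma>"
    "\<alpha> = angle (Q - P) (R - P)" "\<beta> = angle (R - Q) (P - Q)" "\<gamma> = angle (P - R) (Q - R)"
    "dist Q R = k * sin \<alpha>" "dist R P = k * sin \<beta>" "dist P Q = k * sin \<gamma>"
proof -
  let ?k = "dist Q R * dist R P * dist P Q / \<bar>area2 P Q R\<bar>"
  have ne: "P \<noteq> Q" "Q \<noteq> R" "R \<noteq> P"
    using assms by (auto simp: area2_def)
  have "shape (angle (Q - P) (R - P)) (angle (R - Q) (P - Q)) (angle (P - R) (Q - R))"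
    unfolding shape_def using angle_sum[OF assms] angle_strict_bounds[of P Q R]
      angle_strict_bounds[of Q R P] angle_strict_bounds[of R P Q] assms
    by (simp add: area2_rotate[of Q R P] area2_rotate[of P Q R])
  moreover have "?k > 0"
    using ne assms by simp
  moreover have "dist Q R = ?k * sin (angle (Q - P) (R - P))"
    "dist R P = ?k * sin (angle (R - Q) (P - Q))" "dist P Q = ?k * sin (angle (P - R) (Q - R))"
    using ne assms sin_angle[of Q P R] sin_angle[of R Q P] sin_angle[of P R Q]
    by (simp_all add: area2_rotate[of Q R P] area2_rotate[of P Q R] dist_commute)
  ultimately show thesis
    by (intro that[OF _ _ refl refl refl])
qed

section \<open>A factorization implies concurrency\<close>

lemma center_function_symmetric:
  "center_function f \<Longrightarrow> triangle_sides x y z \<Longrightarrow> f x y z = f x z y"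
  unfolding center_function_def by blast

lemma center_function_homogeneous:
  assumes "center_function f"
  obtains n :: real where
    "\<And>t x y z. t > 0 \<Longrightarrow> triangle_sides x y z \<Longrightarrow> f (t * x) (t * y) (t * z) = t powr n * f x y z"
  using assms unfolding center_function_def by blast

lemma shape_rotate: "shape \<alpha> \<beta> \<gamma> \<Longrightarrow> shape \<beta> \<gamma> \<alpha>"
  and shape_swap: "shape \<alpha> \<beta> \<gamma> \<Longrightarrow> shape \<alpha> \<gamma> \<beta>"
  by (auto simp: shape_def)

lemma abs_sin_add_less:
  assumes "sin x \<noteq> 0" "sin y \<noteq> (0::real)"
  shows "\<bar>sin (x + y)\<bar> < \<bar>sin x\<bar> + \<bar>sin y\<bar>"
proof -
  have cos_less: "\<bar>cos t\<bar> < 1" if "sin t \<noteq> 0" for t :: real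
    using that by (simp add: cos_squared_eq flip: abs_square_less_1)
  have "\<bar>sin (x + y)\<bar> \<le> \<bar>sin x\<bar> * \<bar>cos y\<bar> + \<bar>cos x\<bar> * \<bar>sin y\<bar>"
    unfolding sin_add using abs_triangle_ineq[of "sin x * cos y" "cos x * sin y"] by (simp add: abs_mult)
  also have "\<dots> < \<bar>sin x\<bar> * 1 + 1 * \<bar>sin y\<bar>"
    using assms by (intro add_strict_mono mult_strict_left_mono mult_strict_right_mono cos_less) simp_all
  finally show ?thesis by simp
qed

lemma triangle_sides_abs_sin:
  assumes "sin (i - j) \<noteq> 0" "sin (j - k) \<noteq> 0" "sin (k - i) \<noteq> (0::real)"
  shows "triangle_sides \<bar>sin (i - j)\<bar> \<bar>sin (j - k)\<bar> \<bar>sin (k - i)\<bar>"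
proof -
  have less: "\<bar>sin (x - y)\<bar> < \<bar>sin (y - z)\<bar> + \<bar>sin (z - x)\<bar>"
    if "sin (y - z) \<noteq> 0" "sin (z - x) \<noteq> 0" for x y z :: real
    using abs_sin_add_less[OF that] sin_minus[of "y - x"] by simp
  show ?thesis
    unfolding triangle_sides_def using less assms by auto
qed

lemma triangle_sides_sin:
  assumes "shape \<alpha> \<beta> \<gamma>"
  shows "triangle_sides (sin \<alpha>) (sin \<beta>) (sin \<gamma>)"
proof -
  have pos: "sin \<alpha> > 0" "sin \<beta> > 0" "sin \<gamma> > 0"
    using assms unfolding shape_def by (auto intro: sin_gt_zero)
  have "\<beta> + \<gamma> = pi - \<alpha>" "\<gamma> + \<alpha> = pi - \<beta>" "\<alpha> + \<beta> = pi - \<gamma>"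
    using assms unfolding shape_def by linarith+
  then have "sin (\<beta> + \<gamma>) = sin \<alpha>" "sin (\<gamma> + \<alpha>) = sin \<beta>" "sin (\<alpha> + \<beta>) = sin \<gamma>"
    by (simp_all only: sin_pi_minus)
  then show ?thesis
    unfolding triangle_sides_def
    using abs_sin_add_less[of \<beta> \<gamma>] abs_sin_add_less[of \<gamma> \<alpha>] abs_sin_add_less[of \<alpha> \<beta>] pos by simp
qed

text \<open>The constant \<open>K\<close> combines the value of \<open>M\<close> with the scale factor of the triangle, which are the
  same at all three vertices.\<close>

lemma weights_of_factorization:
  assumes cf: "center_function f" and sym: "fully_symmetric M"
    and fac: "\<And>\<alpha> \<beta> \<gamma>. shape \<alpha> \<beta> \<gamma> \<Longrightarrow> shape_function f \<alpha> \<beta> \<gamma> = \<phi> \<alpha> * M \<alpha> \<beta> \<gamma>"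
    and tri: "area2 P Q R \<noteq> 0"
  obtains K where
    "f (dist R P) (dist P Q) (dist Q R) = K * \<phi> (angle (R - Q) (P - Q))"
    "f (dist P Q) (dist Q R) (dist R P) = K * \<phi> (angle (P - R) (Q - R))"
proof -
  obtain n where hom: "\<And>t x y z. t > 0 \<Longrightarrow> triangle_sides x y z \<Longrightarrow>
      f (t * x) (t * y) (t * z) = t powr n * f x y z"
    using center_function_homogeneous[OF cf] by blast
  obtain k \<alpha> \<beta> \<gamma> where "k > 0" and shape: "shape \<alpha> \<beta> \<gamma>"
    and ang: "\<beta> = angle (R - Q) (P - Q)" "\<gamma> = angle (P - R) (Q - R)"
    and dist: "dist Q R = k * sin \<alpha>" "dist R P = k * sin \<beta>" "dist P Q = k * sin \<gamma>"
    using triangle_shape[OF tri] by metis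
  have scaled: "f (k * sin x) (k * sin y) (k * sin z) = k powr n * (\<phi> x * M x y z)"
    if "shape x y z" for x y z
    using hom[OF \<open>k > 0\<close> triangle_sides_sin[OF that]] fac[OF that]
    by (simp add: shape_function_def)
  have "M \<beta> \<gamma> \<alpha> = M \<alpha> \<beta> \<gamma>" "M \<gamma> \<alpha> \<beta> = M \<alpha> \<beta> \<gamma>"
    using sym shape unfolding fully_symmetric_def by blast+
  then have "f (dist R P) (dist P Q) (dist Q R) = (k powr n * M \<alpha> \<beta> \<gamma>) * \<phi> \<beta>"
    "f (dist P Q) (dist Q R) (dist R P) = (k powr n * M \<alpha> \<beta> \<gamma>) * \<phi> \<gamma>"
    unfolding dist using scaled[OF shape_rotate[OF shape]]
      scaled[OF shape_rotate[OF shape_rotate[OF shape]]] by simp_all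
  then show thesis
    using that ang by blast
qed

lemma odd_about_half_pi_angle:
  assumes odd: "odd_about_half_pi \<phi>" and tri: "area2 P Q R \<noteq> 0" and "a \<noteq> 0" "b \<noteq> 0"
    and Q': "Q' - P = a *\<^sub>R (Q - P)" and R': "R' - P = b *\<^sub>R (R - P)"
  shows "\<phi> (angle (Q' - P) (R' - P)) = sgn (a * b) * \<phi> (angle (Q - P) (R - P))"
proof -
  have ne: "Q - P \<noteq> 0" "R - P \<noteq> 0"
    using tri by (auto simp: area2_def)
  have "\<phi> (pi - angle (Q - P) (R - P)) = - \<phi> (angle (Q - P) (R - P))"
    using odd angle_strict_bounds[OF tri] unfolding odd_about_half_pi_def by blast
  then show ?thesis
    using assms(3,4) unfolding Q' R' angle_scaleR[OF ne assms(3,4)]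
    by (auto simp: sgn_if)
qed

lemma concurrent_if_factorization:
  assumes cf: "center_function f"
    and odd: "odd_about_half_pi \<phi>" and sym: "fully_symmetric M"
    and fac: "\<And>\<alpha> \<beta> \<gamma>. shape \<alpha> \<beta> \<gamma> \<Longrightarrow> shape_function f \<alpha> \<beta> \<gamma> = \<phi> \<alpha> * M \<alpha> \<beta> \<gamma>"
    and tri: "\<not> collinear {A, B, C}" and adm: "admissible_transversal A B C l"
    and meets: "meets_sidelines A B C l D E F"
  shows "concurrent_lines (line_to_X f A E F) (line_to_X f B F D) (line_to_X f C D E)"
proof -
  obtain t u r where
    D: "D = (1 - t) *\<^sub>R B + t *\<^sub>R C" and E: "E = (1 - u) *\<^sub>R C + u *\<^sub>R A" and F: "F = (1 - r) *\<^sub>R A + r *\<^sub>R B"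
    and menelaus: "r * t * u + (1 - r) * (1 - t) * (1 - u) = 0"
    and nz: "r \<noteq> 0" "r \<noteq> 1" "t \<noteq> 0" "t \<noteq> 1" "u \<noteq> 0" "u \<noteq> 1"
    using meets_sidelines_points[OF tri adm meets] by metis
  have ABC: "area2 A B C \<noteq> 0"
    using tri by (simp add: collinear_iff_area2)
  have "area2 A E F = (1 - u) * r * - area2 A B C" "area2 B F D = (1 - r) * t * - area2 A B C"
    "area2 C D E = (1 - t) * u * - area2 A B C"
    unfolding D E F area2_def by (simp, algebra)+
  then have areas: "area2 A E F \<noteq> 0" "area2 B F D \<noteq> 0" "area2 C D E \<noteq> 0"
    using ABC nz by simp_all
  then have areas': "area2 E A F \<noteq> 0" "area2 F B D \<noteq> 0" "area2 D C E \<noteq> 0"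
    by (auto simp: area2_def algebra_simps)

  \<comment> \<open>At each point of the transversal the two triangles have sides along the same two lines; the
    ratios of the direction vectors decide between equal and supplementary angles.\<close>
  have sides: "B - F = (- (1 - r) / r) *\<^sub>R (A - F)" "C - D = (- (1 - t) / t) *\<^sub>R (B - D)"
    "A - E = (- (1 - u) / u) *\<^sub>R (C - E)"
    unfolding D E F using nz by (simp_all add: vec_eq_iff field_simps)
  have "D \<in> l" "E \<in> l" "F \<in> l" "collinear l"
    using meets adm unfolding meets_sidelines_def admissible_transversal_def collinear_aff_dim by auto
  then obtain v x y where x: "D - F = x *\<^sub>R v" and y: "E - F = y *\<^sub>R v"
    unfolding collinear_def by metis
  have "D \<noteq> F" "E \<noteq> F" "D \<noteq> E"
    using areas by (auto simp: area2_def)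
  then have "x \<noteq> 0" "y \<noteq> 0" "x \<noteq> y"
    using x y by (auto, metis diff_add_cancel)
  have "E - D = (E - F) - (D - F)" "F - D = - (D - F)" "F - E = - (E - F)" "D - E = (D - F) - (E - F)"
    by simp_all
  then have edges: "D - F = x *\<^sub>R v" "E - F = y *\<^sub>R v" "E - D = (y - x) *\<^sub>R v" "F - D = (- x) *\<^sub>R v"
    "F - E = (- y) *\<^sub>R v" "D - E = (x - y) *\<^sub>R v"
    unfolding x y by (simp_all only: scaleR_left_diff_distrib scaleR_minus_left)
  have line: "D - F = (x / y) *\<^sub>R (E - F)" "E - D = ((y - x) / - x) *\<^sub>R (F - D)"
    "F - E = (- y / (x - y)) *\<^sub>R (D - E)"
    unfolding edges using \<open>x \<noteq> 0\<close> \<open>y \<noteq> 0\<close> \<open>x \<noteq> y\<close> by simp_all (simp flip: scaleR_minus_left)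
  define kF kD kE where "kF = - (1 - r) / r" "kD = - (1 - t) / t" "kE = - (1 - u) / u"
  define mF mD mE where "mF = x / y" "mD = (y - x) / - x" "mE = - y / (x - y)"
  note k = kF_kD_kE_def and m = mF_mD_mE_def
  note sides = sides[folded k] and line = line[folded m]
  have k0: "kF \<noteq> 0" "kD \<noteq> 0" "kE \<noteq> 0" and m0: "mF \<noteq> 0" "mD \<noteq> 0" "mE \<noteq> 0"
    unfolding k m using nz \<open>x \<noteq> 0\<close> \<open>y \<noteq> 0\<close> \<open>x \<noteq> y\<close> by simp_all
  \<comment> \<open>The ratios along the sides multiply to \<open>1\<close> by Menelaus, those along the transversal to \<open>-1\<close>.\<close>
  have "kF * kD * kE = 1"
    unfolding k using nz menelaus by (simp add: field_simps)
  moreover have "mF * mD * mE = - 1"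
    unfolding m using \<open>x \<noteq> 0\<close> \<open>y \<noteq> 0\<close> \<open>x \<noteq> y\<close> by (simp add: field_simps)
  ultimately have "(mF * kF) * (mD * kD) * (mE * kE) = - 1"
    by algebra
  then have signs: "sgn (mF * kF) * sgn (mD * kD) * sgn (mE * kE) = - 1"
    unfolding sgn_mult[symmetric] by simp
  have "area2 F E A \<noteq> 0" "area2 D F B \<noteq> 0" "area2 E D C \<noteq> 0"
    using areas by (auto simp: area2_def algebra_simps)
  note areas_line = this
  have flip:
    "\<phi> (angle (D - F) (B - F)) = sgn (mF * kF) * \<phi> (angle (E - F) (A - F))"
    "\<phi> (angle (E - D) (C - D)) = sgn (mD * kD) * \<phi> (angle (F - D) (B - D))"
    "\<phi> (angle (F - E) (A - E)) = sgn (mE * kE) * \<phi> (angle (D - E) (C - E))"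
    by (rule odd_about_half_pi_angle[OF odd]; fact)+

  obtain K1 where w1: "f (dist F A) (dist A E) (dist E F) = K1 * \<phi> (angle (F - E) (A - E))"
      "f (dist A E) (dist E F) (dist F A) = K1 * \<phi> (angle (A - F) (E - F))"
    using weights_of_factorization[OF cf sym fac areas(1)] by blast
  obtain K2 where w2: "f (dist D B) (dist B F) (dist F D) = K2 * \<phi> (angle (D - F) (B - F))"
      "f (dist B F) (dist F D) (dist D B) = K2 * \<phi> (angle (B - D) (F - D))"
    using weights_of_factorization[OF cf sym fac areas(2)] by blast
  obtain K3 where w3: "f (dist E C) (dist C D) (dist D E) = K3 * \<phi> (angle (E - D) (C - D))"
      "f (dist C D) (dist D E) (dist E C) = K3 * \<phi> (angle (C - E) (D - E))"
    using weights_of_factorization[OF cf sym fac areas(3)] by blast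
  have arith: "K1 * (sE * e) * (K2 * (sF * g)) * (K3 * (sD * d)) + K1 * g * (K2 * d) * (K3 * e) = 0"
    if "sF * sD * sE = - 1" for sE sF sD e g d
    using that by algebra
  show ?thesis
    unfolding concurrent_iff_weights[OF tri adm meets] w1 w2 w3 flip
      angle_commute[of "A - F"] angle_commute[of "B - D"] angle_commute[of "C - E"]
    by (rule arith[OF signs])
qed

section \<open>A transversal for any four directions\<close>

text \<open>Up to a common factor depending on the triangle, the weight of the intersection of the first
  two of three lines with direction angles \<open>i, j, k\<close>. Directions are real numbers, taken modulo \<open>\<pi>\<close>;
  two of them are distinct when the sine of their difference is nonzero.\<close>

definition direction_weight :: "(real \<Rightarrow> real \<Rightarrow> real \<Rightarrow> real) \<Rightarrow> real \<Rightarrow> real \<Rightarrow> real \<Rightarrow> real" where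
  "direction_weight f i j k = f \<bar>sin (i - j)\<bar> \<bar>sin (j - k)\<bar> \<bar>sin (k - i)\<bar>"

lemma affine_hull_2_param: "affine hull {Q, R} = {(1 - t) *\<^sub>R Q + t *\<^sub>R R | t. True}"
  for Q R :: "'a::real_vector"
  unfolding affine_hull_2 by (auto, metis add_diff_cancel_right', smt (verit))

lemma horizontal_line_meets_sideline:
  fixes P Q R :: "real^2"
  assumes "Q$2 \<noteq> R$2" "P$2 = 0" "P \<in> affine hull {Q, R}"
  shows "{X. X$2 = 0} \<inter> affine hull {Q, R} = {P}"
proof -
  have "X = P" if X: "X \<in> affine hull {Q, R}" "X$2 = 0" for X
  proof -
    obtain s t where st: "X = (1 - s) *\<^sub>R Q + s *\<^sub>R R" "P = (1 - t) *\<^sub>R Q + t *\<^sub>R R"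
      using X(1) assms(3) unfolding affine_hull_2_param by blast
    have "P$2 - X$2 = (s - t) * (Q$2 - R$2)"
      unfolding st by (simp add: algebra_simps)
    then have "(s - t) * (Q$2 - R$2) = 0"
      using X(2) assms(2) by simp
    then have "s = t"
      using assms(1) by simp
    then show ?thesis
      by (simp only: st)
  qed
  then show ?thesis
    using assms by blast
qed

lemma horizontal_line_not_parallel:
  fixes Q R :: "real^2"
  assumes "Q$2 \<noteq> R$2"
  shows "\<not> affine_parallel {X. X$2 = 0} (affine hull {Q, R})"
proof
  assume "affine_parallel {X. X$2 = 0} (affine hull {Q, R})"
  then obtain a where "affine hull {Q, R} = (\<lambda>x. a + x) ` {X. X$2 = 0}"
    unfolding affine_parallel_def by blast
  then have "Q \<in> (\<lambda>x. a + x) ` {X. X$2 = 0}" "R \<in> (\<lambda>x. a + x) ` {X. X$2 = 0}"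
    by (auto intro: hull_inc)
  then show False
    using assms by auto
qed

lemma dist_along_direction:
  fixes P Q :: "real^2"
  assumes "sin \<theta> \<noteq> 0" "c = cos \<theta> / sin \<theta>" "P$1 - Q$1 = y * c" "P$2 - Q$2 = y"
  shows "dist P Q = \<bar>y\<bar> / \<bar>sin \<theta>\<bar>"
proof -
  have square_sum: "(y * (c / s))\<^sup>2 + y\<^sup>2 = y\<^sup>2 * (c\<^sup>2 + s\<^sup>2) / s\<^sup>2" if "s \<noteq> 0" for c s :: real
    using that by (simp add: field_simps power2_eq_square)
  have "(dist P Q)\<^sup>2 = (y * (cos \<theta> / sin \<theta>))\<^sup>2 + y\<^sup>2"
    using norm_real2_squared[of "P - Q"] assms by (simp add: dist_norm)
  also have "\<dots> = y\<^sup>2 * ((cos \<theta>)\<^sup>2 + (sin \<theta>)\<^sup>2) / (sin \<theta>)\<^sup>2"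
    using assms(1) by (rule square_sum)
  also have "\<dots> = (\<bar>y\<bar> / \<bar>sin \<theta>\<bar>)\<^sup>2"
    by (simp add: power_divide)
  finally show ?thesis
    by (rule power2_eq_imp_eq) simp_all
qed

lemma dist_horizontal:
  fixes P Q :: "real^2"
  assumes "P$2 = Q$2"
  shows "dist P Q = \<bar>P$1 - Q$1\<bar>"
  using assms by (simp add: dist_vec_def L2_set_def sum_2 dist_real_def)

lemma cot_diff:
  assumes "sin \<theta> \<noteq> 0" "sin \<eta> \<noteq> (0::real)"
  shows "cos \<theta> / sin \<theta> - cos \<eta> / sin \<eta> = sin (\<eta> - \<theta>) / (sin \<theta> * sin \<eta>)"
  using assms by (simp add: sin_diff field_simps)

text \<open>The transversal is horizontal, and \<open>BC, CA, AB\<close> have direction angles \<open>\<theta>1, \<theta>2, \<theta>3\<close>. With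
  \<open>c\<^sub>i = cot \<theta>\<^sub>i\<close> the sides are chosen tangent to a common parabola, which makes the coordinates
  of \<open>A, B, C\<close> polynomial in the \<open>c\<^sub>i\<close> and their heights \<open>x - c\<^sub>i\<close> distinct; the heights are
  nonzero because \<open>x\<close> is large.\<close>

lemma transversal_with_directions:
  assumes s: "sin \<theta>1 \<noteq> 0" "sin \<theta>2 \<noteq> 0" "sin \<theta>3 \<noteq> (0::real)"
    and ds: "sin (\<theta>1 - \<theta>2) \<noteq> 0" "sin (\<theta>2 - \<theta>3) \<noteq> 0" "sin (\<theta>3 - \<theta>1) \<noteq> 0"
  obtains A B C l D E F a b c where
    "\<not> collinear {A, B, C}" "admissible_transversal A B C l" "meets_sidelines A B C l D E F"
    "a > 0" "b > 0" "c > 0"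
    "dist F A = a * \<bar>sin \<theta>2\<bar>" "dist A E = a * \<bar>sin \<theta>3\<bar>" "dist E F = a * \<bar>sin (\<theta>2 - \<theta>3)\<bar>"
    "dist D B = b * \<bar>sin \<theta>3\<bar>" "dist B F = b * \<bar>sin \<theta>1\<bar>" "dist F D = b * \<bar>sin (\<theta>3 - \<theta>1)\<bar>"
    "dist E C = c * \<bar>sin \<theta>1\<bar>" "dist C D = c * \<bar>sin \<theta>2\<bar>" "dist D E = c * \<bar>sin (\<theta>1 - \<theta>2)\<bar>"
proof -
  define c1 c2 c3 where "c1 = cos \<theta>1 / sin \<theta>1" "c2 = cos \<theta>2 / sin \<theta>2" "c3 = cos \<theta>3 / sin \<theta>3"
  note c_def = c1_c2_c3_def
  define x where "x = \<bar>c1\<bar> + \<bar>c2\<bar> + \<bar>c3\<bar> + 1"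
  have x: "x \<noteq> c1" "x \<noteq> c2" "x \<noteq> c3"
    unfolding x_def by auto
  have diffs: "c1 - c2 = sin (\<theta>2 - \<theta>1) / (sin \<theta>1 * sin \<theta>2)" "c2 - c3 = sin (\<theta>3 - \<theta>2) / (sin \<theta>2 * sin \<theta>3)"
    "c3 - c1 = sin (\<theta>1 - \<theta>3) / (sin \<theta>3 * sin \<theta>1)"
    unfolding c_def by (rule cot_diff; fact)+
  have sin_swap: "sin (\<theta>2 - \<theta>1) = - sin (\<theta>1 - \<theta>2)" "sin (\<theta>3 - \<theta>2) = - sin (\<theta>2 - \<theta>3)"
    "sin (\<theta>1 - \<theta>3) = - sin (\<theta>3 - \<theta>1)"
    by (simp_all flip: sin_minus)
  have "c1 - c2 \<noteq> 0" "c2 - c3 \<noteq> 0" "c3 - c1 \<noteq> 0"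
    unfolding diffs sin_swap using s ds by simp_all
  then have ne: "c1 \<noteq> c2" "c2 \<noteq> c3" "c3 \<noteq> c1"
    by simp_all
  define A B C D E F :: "real^2" where "A = vector [- c1 * (c2 + c3), x - c1]"
    "B = vector [- c2 * (c3 + c1), x - c2]" "C = vector [- c3 * (c1 + c2), x - c3]"
    "D = vector [- c2 * c3 - x * c1, 0]" "E = vector [- c3 * c1 - x * c2, 0]"
    "F = vector [- c1 * c2 - x * c3, 0]"
  note pts = A_B_C_D_E_F_def
  define l where "l = {X :: real^2. X$2 = 0}"
  have "area2 A B C = (c1 - c2) * (c1 - c3) * (c3 - c2)"
    unfolding area2_def pts by simp algebra
  then have tri: "\<not> collinear {A, B, C}"
    using ne by (simp add: collinear_iff_area2)
  have heights: "B$2 \<noteq> C$2" "C$2 \<noteq> A$2" "A$2 \<noteq> B$2"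
    using ne by (simp_all add: pts)
  have l_eq: "l = {X. axis 2 1 \<bullet> X = 0}"
    unfolding l_def by (simp add: inner_axis' inner_real_def)
  have "affine l" "aff_dim l = 1"
    unfolding l_eq by (simp_all add: affine_hyperplane aff_dim_hyperplane axis_eq_0_iff)
  then have adm: "admissible_transversal A B C l"
    unfolding admissible_transversal_def
    using x horizontal_line_not_parallel[OF heights(1)] horizontal_line_not_parallel[OF heights(2)]
      horizontal_line_not_parallel[OF heights(3)] by (simp add: l_def) (simp add: pts)
  have on_line: "(vector [- q * r - x * p, 0] :: real^2)
      \<in> affine hull {vector [- q * (r + p), x - q], vector [- r * (p + q), x - r]}"
    if "q \<noteq> r" for p q r
  proof -
    define s where "s = (x - q) / (r - q)"
    have "s * (r - q) = x - q"
      using that by (simp add: s_def)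
    then have "- q * r - x * p = (1 - s) * (- q * (r + p)) + s * (- r * (p + q))"
      "0 = (1 - s) * (x - q) + s * (x - r)"
      by algebra+
    then have "(vector [- q * r - x * p, 0] :: real^2) = (1 - s) *\<^sub>R vector [- q * (r + p), x - q]
        + s *\<^sub>R vector [- r * (p + q), x - r]"
      unfolding vec_eq_iff forall_2 by simp
    then show ?thesis
      unfolding affine_hull_2_param by blast
  qed
  have hull: "D \<in> affine hull {B, C}" "E \<in> affine hull {C, A}" "F \<in> affine hull {A, B}"
    unfolding pts using ne by (intro on_line; simp)+
  have "D$2 = 0" "E$2 = 0" "F$2 = 0"
    by (simp_all add: pts)
  then have meets: "meets_sidelines A B C l D E F"
    unfolding meets_sidelines_def l_def
    using heights hull by (simp add: horizontal_line_meets_sideline)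
  define a b c where "a = \<bar>x - c1\<bar> / (\<bar>sin \<theta>2\<bar> * \<bar>sin \<theta>3\<bar>)" "b = \<bar>x - c2\<bar> / (\<bar>sin \<theta>3\<bar> * \<bar>sin \<theta>1\<bar>)"
    "c = \<bar>x - c3\<bar> / (\<bar>sin \<theta>1\<bar> * \<bar>sin \<theta>2\<bar>)"
  note abc = a_b_c_def
  have pos: "a > 0" "b > 0" "c > 0"
    unfolding abc using x s by simp_all
  have "dist A F = \<bar>x - c1\<bar> / \<bar>sin \<theta>3\<bar>" "dist A E = \<bar>x - c1\<bar> / \<bar>sin \<theta>2\<bar>"
    "dist B D = \<bar>x - c2\<bar> / \<bar>sin \<theta>1\<bar>" "dist B F = \<bar>x - c2\<bar> / \<bar>sin \<theta>3\<bar>"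
    "dist C E = \<bar>x - c3\<bar> / \<bar>sin \<theta>2\<bar>" "dist C D = \<bar>x - c3\<bar> / \<bar>sin \<theta>1\<bar>"
    by (rule dist_along_direction[OF s(1) c_def(1)] dist_along_direction[OF s(2) c_def(2)]
        dist_along_direction[OF s(3) c_def(3)]; simp add: pts algebra_simps)+
  moreover have "a * \<bar>sin \<theta>2\<bar> = \<bar>x - c1\<bar> / \<bar>sin \<theta>3\<bar>" "a * \<bar>sin \<theta>3\<bar> = \<bar>x - c1\<bar> / \<bar>sin \<theta>2\<bar>"
    "b * \<bar>sin \<theta>3\<bar> = \<bar>x - c2\<bar> / \<bar>sin \<theta>1\<bar>" "b * \<bar>sin \<theta>1\<bar> = \<bar>x - c2\<bar> / \<bar>sin \<theta>3\<bar>"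
    "c * \<bar>sin \<theta>1\<bar> = \<bar>x - c3\<bar> / \<bar>sin \<theta>2\<bar>" "c * \<bar>sin \<theta>2\<bar> = \<bar>x - c3\<bar> / \<bar>sin \<theta>1\<bar>"
    unfolding abc using s by simp_all
  ultimately have legs: "dist F A = a * \<bar>sin \<theta>2\<bar>" "dist A E = a * \<bar>sin \<theta>3\<bar>"
    "dist D B = b * \<bar>sin \<theta>3\<bar>" "dist B F = b * \<bar>sin \<theta>1\<bar>"
    "dist E C = c * \<bar>sin \<theta>1\<bar>" "dist C D = c * \<bar>sin \<theta>2\<bar>"
    by (simp_all only: dist_commute[of F A] dist_commute[of D B] dist_commute[of E C])
  have "E$1 - F$1 = - ((x - c1) * (c2 - c3))" "F$1 - D$1 = - ((x - c2) * (c3 - c1))"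
    "D$1 - E$1 = - ((x - c3) * (c1 - c2))"
    unfolding pts vector_2 by algebra+
  moreover have "E$2 = F$2" "F$2 = D$2" "D$2 = E$2"
    by (simp_all add: pts)
  ultimately have "dist E F = \<bar>(x - c1) * (c2 - c3)\<bar>" "dist F D = \<bar>(x - c2) * (c3 - c1)\<bar>"
    "dist D E = \<bar>(x - c3) * (c1 - c2)\<bar>"
    by (simp_all only: dist_horizontal abs_minus_cancel)
  then have bases: "dist E F = a * \<bar>sin (\<theta>2 - \<theta>3)\<bar>" "dist F D = b * \<bar>sin (\<theta>3 - \<theta>1)\<bar>"
    "dist D E = c * \<bar>sin (\<theta>1 - \<theta>2)\<bar>"
    unfolding abs_mult diffs sin_swap abs_divide abs_minus_cancel abc by simp_all
  show thesis
    by (rule that[OF tri adm meets pos legs(1,2) bases(1) legs(3,4) bases(2) legs(5,6) bases(3)])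
qed

text \<open>The two weights, at the points of a horizontal transversal, of a triangle
  that it cuts off. The other two sides have direction angles \<open>\<theta>, \<eta>\<close>, and \<open>c\<close> is the diameter of the
  circumscribed circle.\<close>

lemma direction_weight_scaled:
  assumes cf: "center_function f" and "c > 0"
    and s: "sin \<theta> \<noteq> 0" "sin \<eta> \<noteq> (0::real)" "sin (\<theta> - \<eta>) \<noteq> 0"
  obtains \<kappa> where "\<kappa> > 0"
    "f (c * \<bar>sin \<theta>\<bar>) (c * \<bar>sin \<eta>\<bar>) (c * \<bar>sin (\<theta> - \<eta>)\<bar>) = \<kappa> * direction_weight f 0 \<theta> \<eta>"
    "f (c * \<bar>sin \<eta>\<bar>) (c * \<bar>sin (\<theta> - \<eta>)\<bar>) (c * \<bar>sin \<theta>\<bar>) = \<kappa> * direction_weight f 0 \<eta> \<theta>"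
proof -
  obtain n where hom: "\<And>t x y z. t > 0 \<Longrightarrow> triangle_sides x y z \<Longrightarrow>
      f (t * x) (t * y) (t * z) = t powr n * f x y z"
    using center_function_homogeneous[OF cf] by blast
  have "triangle_sides \<bar>sin \<theta>\<bar> \<bar>sin \<eta>\<bar> \<bar>sin (\<theta> - \<eta>)\<bar>"
    using triangle_sides_abs_sin[of \<theta> 0 \<eta>] s sin_minus[of "\<theta> - \<eta>"] by simp
  then have tri: "triangle_sides \<bar>sin \<theta>\<bar> \<bar>sin \<eta>\<bar> \<bar>sin (\<theta> - \<eta>)\<bar>"
    "triangle_sides \<bar>sin \<eta>\<bar> \<bar>sin (\<theta> - \<eta>)\<bar> \<bar>sin \<theta>\<bar>"
    by (auto simp: triangle_sides_def)
  have "direction_weight f 0 \<theta> \<eta> = f \<bar>sin \<theta>\<bar> \<bar>sin \<eta>\<bar> \<bar>sin (\<theta> - \<eta>)\<bar>"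
    "direction_weight f 0 \<eta> \<theta> = f \<bar>sin \<eta>\<bar> \<bar>sin (\<theta> - \<eta>)\<bar> \<bar>sin \<theta>\<bar>"
    using center_function_symmetric[OF cf tri(1)] sin_minus[of "\<theta> - \<eta>"]
    by (simp_all add: direction_weight_def)
  then show thesis
    using that[of "c powr n"] hom[OF \<open>c > 0\<close>] tri \<open>c > 0\<close> by simp
qed

section \<open>Vanishing weights\<close>

lemma sin_diff_swap: "sin (i - j) = 0 \<longleftrightarrow> sin (j - i) = (0::real)"
  by (metis minus_diff_eq neg_equal_0_iff_equal sin_minus)

lemma sin_diff_nonzero:
  fixes x y :: real
  assumes "x < y" "y < x + pi"
  shows "sin (y - x) \<noteq> 0" "sin (x - y) \<noteq> 0"
proof -
  have "sin (y - x) > 0"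
    using assms by (intro sin_gt_zero) auto
  then show "sin (y - x) \<noteq> 0" "sin (x - y) \<noteq> 0"
    using sin_diff_swap[of x y] by auto
qed

text \<open>The properties of the weights \<open>direction_weight f\<close> used from here on: symmetry in the two
  lines through the vertex, invariance under rotations and reflections, directions modulo \<open>\<pi>\<close>, at most one zero weight in each triangle, the concurrency relation for
  the transversal of direction \<open>i\<close>, and stability of nonvanishing away from right angles.\<close>

locale four_line_weights =
  fixes w :: "real \<Rightarrow> real \<Rightarrow> real \<Rightarrow> real"
  assumes vertex_sym: "\<And>i j k. sin (i - j) \<noteq> 0 \<Longrightarrow> sin (j - k) \<noteq> 0 \<Longrightarrow> sin (k - i) \<noteq> 0 \<Longrightarrow> w i j k = w j i k"
    and rotate: "\<And>t i j k. w (i + t) (j + t) (k + t) = w i j k"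
    and reflect: "\<And>i j k. w (- i) (- j) (- k) = w i j k"
    and period_2: "\<And>i j k. w i (j + pi) k = w i j k"
    and period_3: "\<And>i j k. w i j (k + pi) = w i j k"
    and not_both_zero: "\<And>i j k. sin (i - j) \<noteq> 0 \<Longrightarrow> sin (j - k) \<noteq> 0 \<Longrightarrow> sin (k - i) \<noteq> 0 \<Longrightarrow>
          w i j k = 0 \<Longrightarrow> w i k j \<noteq> 0"
    and four_lines: "\<And>i j k l. sin (i - j) \<noteq> 0 \<Longrightarrow> sin (i - k) \<noteq> 0 \<Longrightarrow> sin (i - l) \<noteq> 0 \<Longrightarrow>
          sin (j - k) \<noteq> 0 \<Longrightarrow> sin (k - l) \<noteq> 0 \<Longrightarrow> sin (l - j) \<noteq> 0 \<Longrightarrow>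
          w i j k * w i k l * w i l j + w i k j * w i l k * w i j l = 0"
    and nonzero_open: "\<And>i j k. sin (i - j) \<noteq> 0 \<Longrightarrow> sin (j - k) \<noteq> 0 \<Longrightarrow> sin (k - i) \<noteq> 0 \<Longrightarrow>
          cos (i - j) \<noteq> 0 \<Longrightarrow> w i j k \<noteq> 0 \<Longrightarrow> \<forall>\<^sub>F l in nhds k. w i j l \<noteq> 0"
begin

text \<open>Three lines of directions \<open>i, j, k\<close> form a triangle whose vertex on the first two has weight
  zero.\<close>

definition vanishes :: "real \<Rightarrow> real \<Rightarrow> real \<Rightarrow> bool" where
  "vanishes i j k \<longleftrightarrow> sin (i - j) \<noteq> 0 \<and> sin (j - k) \<noteq> 0 \<and> sin (k - i) \<noteq> 0 \<and> w i j k = 0"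

lemma vanishes_sym: "vanishes i j k \<Longrightarrow> vanishes j i k"
  unfolding vanishes_def using vertex_sym[of i j k] sin_diff_swap by metis

lemma vanishes_once: "vanishes i j k \<Longrightarrow> \<not> vanishes i k j"
  unfolding vanishes_def using not_both_zero[of i j k] by metis

text \<open>The term \<open>w i j k * w i k l * w i l j\<close> of the concurrency relation vanishes, hence so does the
  other one, whose factor \<open>w i k j\<close> is nonzero.\<close>

lemma vanishes_exchange:
  assumes "vanishes i j k" "sin (i - l) \<noteq> 0" "sin (j - l) \<noteq> 0" "sin (k - l) \<noteq> 0"
  shows "vanishes i j l \<or> vanishes i l k"
proof -
  have ne: "sin (i - j) \<noteq> 0" "sin (j - k) \<noteq> 0" "sin (k - i) \<noteq> 0" "sin (i - k) \<noteq> 0"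
    "sin (l - i) \<noteq> 0" "sin (l - j) \<noteq> 0" "sin (l - k) \<noteq> 0" "sin (k - j) \<noteq> 0" "sin (j - i) \<noteq> 0"
    using assms sin_diff_swap unfolding vanishes_def by metis+
  have "w i k j \<noteq> 0"
    using vanishes_once[OF assms(1)] ne unfolding vanishes_def by blast
  moreover have "w i k j * w i l k * w i j l = 0"
    using four_lines[of i j k l] ne assms unfolding vanishes_def by simp
  ultimately show ?thesis
    using assms ne unfolding vanishes_def by auto
qed

text \<open>Otherwise exchanging \<open>k\<close> for \<open>z\<close> in the first premise and for \<open>y\<close> in the second gives two zero
  weights in the triangle \<open>x, y, z\<close>. So the relation \<open>x = y\<close> or \<open>vanishes x y k\<close> is an equivalence on
  its field for each \<open>k\<close>.\<close>

lemma vanishes_trans: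
  assumes xy: "vanishes x y k" and xz: "vanishes x z k" and yz: "sin (y - z) \<noteq> 0"
  shows "vanishes y z k"
proof (rule ccontr)
  assume not: "\<not> vanishes y z k"
  have ne: "sin (x - y) \<noteq> 0" "sin (x - z) \<noteq> 0" "sin (y - x) \<noteq> 0" "sin (z - x) \<noteq> 0"
     "sin (k - y) \<noteq> 0" "sin (k - z) \<noteq> 0" "sin (z - y) \<noteq> 0"
    using assms sin_diff_swap unfolding vanishes_def by metis+
  have "vanishes y x z"
    using vanishes_exchange[OF vanishes_sym[OF xy], of z] not ne yz by blast
  moreover have "vanishes z x y"
    using vanishes_exchange[OF vanishes_sym[OF xz], of y] not ne vanishes_sym[of z y k] by blast
  ultimately show False
    using vanishes_once vanishes_sym by blast
qed

text \<open>By reflection in \<open>y\<close> the other base angle would have weight zero as well.\<close>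

lemma not_vanishes_isosceles:
  assumes "y - x = v - y"
  shows "\<not> vanishes x y v"
proof
  assume van: "vanishes x y v"
  have "v = 2 * y - x" using assms by simp
  have "w (- v + 2 * y) (- y + 2 * y) (- x + 2 * y) = w v y x"
    unfolding rotate reflect ..
  then have "w x y v = w v y x"
    using assms by (simp add: \<open>v = 2 * y - x\<close>)
  then have "vanishes v y x"
    using van sin_diff_swap unfolding vanishes_def by metis
  then show False
    using van vanishes_once vanishes_sym by blast
qed

text \<open>No equivalence class for \<open>k\<close> contains an interval of directions. Let \<open>v\<close> be the first direction
  beyond the interval, up to \<open>k + \<pi>\<close>, near which the class is left. For \<open>x < y\<close> in the class
  and any \<open>l\<close> outside it, \<open>vanishes x y l\<close> by exchange. Letting \<open>l\<close> tend to \<open>v\<close> with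
  \<open>y - x = v - y\<close> contradicts the isosceles case.\<close>

lemma not_vanishes_on_interval:
  assumes "k \<le> p" "p < q" "q \<le> k + pi"
    and van: "\<And>x y. p < x \<Longrightarrow> x < y \<Longrightarrow> y < q \<Longrightarrow> vanishes x y k"
  shows False
proof -
  define x0 where "x0 = (p + q) / 2"
  have x0: "p < x0" "x0 < q"
    using \<open>p < q\<close> by (simp_all add: x0_def)
  define N where "N = {l. x0 < l \<and> l < k + pi \<and> \<not> vanishes x0 l k}"
  \<comment> \<open>\<open>N\<close> consists of the directions past \<open>x0\<close> outside the class of \<open>x0\<close>.\<close>
  have pairs: "vanishes x y k" if "x0 < x" "x < y" "y < k + pi" "x \<notin> N" "y \<notin> N" for x y
  proof -
    have "vanishes x0 x k" "vanishes x0 y k"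
      using that by (auto simp: N_def)
    moreover have "sin (x - y) \<noteq> 0"
      using that x0 assms(1) by (intro sin_diff_nonzero) linarith+
    ultimately show ?thesis
      by (rule vanishes_trans)
  qed
  show False
  proof (cases "N = {}")
    case True
    \<comment> \<open>The class reaches \<open>k + \<pi>\<close>, which is the direction \<open>k\<close> again.\<close>
    define y where "y = (k + pi + (x0 + k + pi) / 2) / 2"
    define x where "x = (x0 + k + pi) / 2"
    have xy: "x0 < x" "x < y" "y < k + pi" "y - x = (k + pi) - y"
      using x0 assms(3) by (simp_all add: x_def y_def field_simps)
    then have "vanishes x y k"
      using pairs True by auto
    moreover have "sin (y - (k + pi)) = - sin (y - k)" "sin (k + pi - x) = - sin (k - x)"
      using sin_minus_pi[of "y - k"] sin_periodic_pi[of "k - x"] by (simp_all add: algebra_simps)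
    ultimately have "vanishes x y (k + pi)"
      unfolding vanishes_def period_3 by simp
    then show False
      using not_vanishes_isosceles xy(4) by blast
  next
    case False
    define v where "v = Inf N"
    have "bdd_below N"
      unfolding N_def by (rule bdd_belowI[of _ x0]) auto
    have "q \<le> l" if "l \<in> N" for l
      using that van[of x0 l] x0 unfolding N_def by force
    then have "q \<le> v"
      unfolding v_def using False by (intro cInf_greatest)
    have below: "l \<notin> N" if "l < v" for l
      using that cInf_lower[OF _ \<open>bdd_below N\<close>] unfolding v_def by force
    obtain m where "m \<in> N"
      using False by blast
    then have "v < k + pi"
      using cInf_lower[OF _ \<open>bdd_below N\<close>] unfolding v_def N_def by force
    define x y where "x = (x0 + v) / 2" "y = (x + v) / 2"
    have xy: "x0 < x" "x < y" "y < v" "y - x = v - y"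
      using x0 \<open>q \<le> v\<close> by (simp_all add: x_y_def field_simps)
    have at_N: "vanishes x y l" if "l \<in> N" for l
    proof -
      have l: "v \<le> l" "l < k + pi" "\<not> vanishes x0 l k"
        using that cInf_lower[OF that \<open>bdd_below N\<close>] unfolding v_def N_def by auto
      have ne: "sin (x0 - x) \<noteq> 0" "sin (x - l) \<noteq> 0" "sin (y - l) \<noteq> 0" "sin (k - l) \<noteq> 0" "sin (x0 - l) \<noteq> 0" "sin (l - x) \<noteq> 0"
        by (rule sin_diff_nonzero; use xy l x0 assms(1) in linarith)+
      have "\<not> vanishes x l k"
      proof
        assume "vanishes x l k"
        moreover have "vanishes x x0 k"
          using below[of x] xy \<open>v < k + pi\<close> vanishes_sym unfolding N_def by auto
        ultimately show False
          using l(3) vanishes_trans[of x x0 k l] ne by blast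
      qed
      moreover have "vanishes x y k"
        using pairs xy below \<open>v < k + pi\<close> by auto
      ultimately show ?thesis
        using vanishes_exchange[of x y k l] ne by blast
    qed
    have ne: "sin (x - y) \<noteq> 0" "sin (y - v) \<noteq> 0" "sin (v - x) \<noteq> 0"
      by (rule sin_diff_nonzero; use xy \<open>v < k + pi\<close> x0 assms(1) in linarith)+
    have "w x y v \<noteq> 0"
      using not_vanishes_isosceles[OF xy(4)] ne unfolding vanishes_def by blast
    moreover have "cos (x - y) \<noteq> 0"
    proof -
      have "0 < y - x" "y - x < pi / 2"
        using xy x0 \<open>v < k + pi\<close> assms(1) by (auto simp: x_y_def field_simps)
      then have "cos (y - x) > 0"
        by (intro cos_gt_zero_pi) auto
      then show ?thesis
        by (metis cos_minus less_irrefl minus_diff_eq)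
    qed
    ultimately obtain e where "e > 0" and e: "\<And>l. dist l v < e \<Longrightarrow> w x y l \<noteq> 0"
      using nonzero_open[OF ne] unfolding eventually_nhds_metric by blast
    have "v < v + e"
      using \<open>e > 0\<close> by simp
    then obtain l where "l \<in> N" "l < v + e"
      using cInf_lessD[OF False] unfolding v_def by blast
    then have "dist l v < e"
      using cInf_lower[OF _ \<open>bdd_below N\<close>] unfolding v_def dist_real_def by force
    then show False
      using e at_N[OF \<open>l \<in> N\<close>] unfolding vanishes_def by blast
  qed
qed

lemma period_3_int: "w i j (k + of_int n * pi) = w i j k"
proof (induction n rule: int_induct[of _ 0])
  case (step1 n)
  then show ?case
    using period_3[of i j "k + of_int n * pi"] by (simp add: algebra_simps)
next
  case (step2 n)
  then show ?case
    using period_3[of i j "k + (of_int n - 1) * pi"] by (simp add: algebra_simps)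
qed simp

lemma sin_plus_int_pi_zero: "sin (x + of_int n * pi) = 0 \<longleftrightarrow> sin x = (0::real)"
  by (simp add: sin_add mult.commute) 

lemma translate_between:
  fixes k l :: real
  assumes "sin (k - l) \<noteq> 0"
  obtains n :: int where "k < l + of_int n * pi" "l + of_int n * pi < k + pi"
proof -
  define m where "m = \<lfloor>(l - k) / pi\<rfloor>"
  have m: "of_int m * pi \<le> l - k" "l - k < (of_int m + 1) * pi"
    unfolding m_def using of_int_floor_le[of "(l - k) / pi"] floor_correct[of "(l - k) / pi"]
    by (simp_all only: pos_le_divide_eq[OF pi_gt_zero] pos_divide_less_eq[OF pi_gt_zero] of_int_add of_int_1)
  have "sin (l - k) \<noteq> 0"
    using assms sin_diff_swap by blast
  then have "of_int m * pi \<noteq> l - k"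
    by (metis sin_zero_iff_int2)
  then show thesis
    using that[of "- m"] m by (simp add: algebra_simps)
qed

text \<open>If the weight were nonzero at \<open>l\<close>, then it would be so near \<open>l\<close>, and by exchange the
  directions near \<open>l\<close> would all lie in the class of \<open>i\<close> for \<open>k\<close>.\<close>

lemma vanishes_persists_oblique:
  assumes van: "vanishes i j k" and "cos (i - j) \<noteq> 0"
    and l: "sin (j - l) \<noteq> 0" "sin (l - i) \<noteq> 0"
  shows "vanishes i j l"
proof (cases "sin (k - l) = 0")
  case True
  then obtain n :: int where "k - l = of_int n * pi"
    using sin_zero_iff_int2 by blast
  then have "w i j k = w i j l"
    using period_3_int[of i j l n] by (simp add: algebra_simps)
  then show ?thesis
    using van l unfolding vanishes_def by simp
next
  case False
  then obtain n :: int where n: "k < l + of_int n * pi" "l + of_int n * pi < k + pi"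
    by (rule translate_between)
  define m where "m = l + of_int n * pi"
  have m: "k < m" "m < k + pi"
    using n by (simp_all add: m_def)
  have ij: "sin (i - j) \<noteq> 0"
    using van unfolding vanishes_def by blast
  have jm: "sin (j - m) \<noteq> 0" and mi: "sin (m - i) \<noteq> 0"
    using l sin_plus_int_pi_zero[of "l - i" n] sin_plus_int_pi_zero[of "l - j" n] sin_diff_swap[of j] 
    unfolding m_def by (simp_all add: algebra_simps)
  show ?thesis
  proof (rule ccontr)
    assume not: "\<not> vanishes i j l"
    then have "w i j m \<noteq> 0"
      using l ij period_3_int unfolding vanishes_def m_def by simp
    then have "\<forall>\<^sub>F x in nhds m. w i j x \<noteq> 0"
      using nonzero_open[OF ij jm mi \<open>cos (i - j) \<noteq> 0\<close>] by blast
    moreover have "\<forall>\<^sub>F x in nhds m. sin (j - x) \<noteq> 0" "\<forall>\<^sub>F x in nhds m. sin (x - i) \<noteq> 0"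
      using jm mi by (auto intro!: tendsto_imp_eventually_ne tendsto_intros filterlim_ident)
    moreover have "\<forall>\<^sub>F x in nhds m. k < x" "\<forall>\<^sub>F x in nhds m. x < k + pi"
      using m by (auto intro: order_tendstoD filterlim_ident)
    ultimately have "\<forall>\<^sub>F x in nhds m. w i j x \<noteq> 0 \<and> sin (j - x) \<noteq> 0 \<and> sin (x - i) \<noteq> 0 \<and> k < x \<and> x < k + pi"
      by eventually_elim simp
    then obtain e where "e > 0" and e: "\<And>x. dist x m < e \<Longrightarrow>
        w i j x \<noteq> 0 \<and> sin (j - x) \<noteq> 0 \<and> sin (x - i) \<noteq> 0 \<and> k < x \<and> x < k + pi"
      unfolding eventually_nhds_metric by blast
    have near: "vanishes i x k" if "dist x m < e" for x
      using vanishes_exchange[OF van, of x] e[OF that] sin_diff_nonzero[of k x] sin_diff_swap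
      unfolding vanishes_def by metis
    have "vanishes x y k" if "m - e / 2 < x" "x < y" "y < m + e / 2" for x y
    proof -
      have "dist x m < e" "dist y m < e"
        using that by (auto simp: dist_real_def)
      then show ?thesis
        using near[of x] near[of y] vanishes_trans[of i x k y] sin_diff_nonzero[of x y] that(2) e[of x] e[of y] by force
    qed
    moreover have "k \<le> m - e / 2" "m + e / 2 \<le> k + pi"
      using e[of "m - e / 2"] e[of "m + e / 2"] \<open>e > 0\<close> by (auto simp: dist_real_def)
    ultimately show False
      using not_vanishes_on_interval[of k "m - e / 2" "m + e / 2"] \<open>e > 0\<close> by auto
  qed
qed

text \<open>When \<open>i\<close> and \<open>j\<close> are perpendicular, stability is not available; but then \<open>l\<close> is perpendicular to
  neither, and the oblique case gives the triangle \<open>i, j, l\<close> two zero weights.\<close>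

lemma vanishes_persists:
  assumes van: "vanishes i j k" and l: "sin (j - l) \<noteq> 0" "sin (l - i) \<noteq> 0"
  shows "vanishes i j l"
proof (cases "cos (i - j) = 0 \<and> sin (k - l) \<noteq> 0")
  case False
  show ?thesis
  proof (cases "cos (i - j) = 0")
    case True
    with False obtain n :: int where "k - l = of_int n * pi"
      using sin_zero_iff_int2 by blast
    then have "w i j k = w i j l"
      using period_3_int[of i j l n] by (simp add: algebra_simps)
    then show ?thesis
      using van l unfolding vanishes_def by simp
  qed (use vanishes_persists_oblique assms in blast)
next
  case True
  have ij: "sin (i - j) \<noteq> 0" and ne: "sin (i - l) \<noteq> 0" "sin (k - l) \<noteq> 0" "sin (l - k) \<noteq> 0" "sin (l - j) \<noteq> 0"
    "sin (j - i) \<noteq> 0"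
    using van l True sin_diff_swap unfolding vanishes_def by metis+
  have "sin (j - l) = sin ((i - l) - (i - j))" "sin (i - l) = sin ((j - l) + (i - j))"
    by simp_all
  then have cos: "cos (i - l) \<noteq> 0" "cos (j - l) \<noteq> 0"
    using True l ne unfolding sin_diff[of "i - l"] sin_add[of "j - l"] by auto
  show ?thesis
  proof (rule ccontr)
    assume not: "\<not> vanishes i j l"
    have "vanishes i l k"
      using vanishes_exchange[OF van, of l] not l ne by blast
    then have "vanishes i l j"
      using vanishes_persists_oblique cos(1) ne ij by blast
    moreover have "vanishes j l k"
      using vanishes_exchange[OF vanishes_sym[OF van], of l] not l ne vanishes_sym by blast
    then have "vanishes j l i"
      by (rule vanishes_persists_oblique) fact+
    ultimately show False
      using vanishes_once vanishes_sym by blast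
  qed
qed

section \<open>The odd function\<close>

text \<open>The cocycle \<open>- w 0 x y / w 0 y x\<close> with \<open>y = \<pi>/4\<close>, completed by the value \<open>1\<close> at
  \<open>x = \<pi>/4\<close>, where \<open>x\<close> and \<open>y\<close> are not distinct.\<close>

definition ratio_function :: "real \<Rightarrow> real" where
  "ratio_function t = (if t = pi / 4 then 1 else - w 0 t (pi / 4) / w 0 (pi / 4) t)"

lemma sin_diff_nonzero_0_pi:
  fixes x y :: real
  assumes "0 < x" "x < pi" "0 < y" "y < pi" "x \<noteq> y"
  shows "sin (0 - x) \<noteq> 0" "sin (x - y) \<noteq> 0" "sin (y - 0) \<noteq> 0"
proof -
  show "sin (x - y) \<noteq> 0"
    using assms by (cases "x < y") (simp_all add: sin_diff_nonzero)
  show "sin (0 - x) \<noteq> 0" "sin (y - 0) \<noteq> 0"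
    using sin_gt_zero[of x] sin_gt_zero[of y] assms by auto
qed

lemma vanishes_0_iff:
  assumes "0 < x" "x < pi" "0 < y" "y < pi" "x \<noteq> y"
  shows "vanishes 0 x y \<longleftrightarrow> w 0 x y = 0"
  using sin_diff_nonzero_0_pi[OF assms] unfolding vanishes_def by simp

text \<open>The triangle with sides of directions \<open>0, \<pi>/4, -\<pi>/4\<close> is isosceles.\<close>

lemma quarter_nonzero:
  assumes "0 < x" "x < pi" "x \<noteq> pi / 4"
  shows "w 0 (pi / 4) x \<noteq> 0"
proof
  assume "w 0 (pi / 4) x = 0"
  then have "vanishes 0 (pi / 4) x"
    using vanishes_0_iff[of "pi / 4" x] assms by simp
  then have "vanishes 0 (pi / 4) (- (pi / 4))"
    by (rule vanishes_persists) (simp_all add: sin_45)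
  then have "vanishes (pi / 4) 0 (- (pi / 4))"
    by (rule vanishes_sym)
  then show False
    using not_vanishes_isosceles[of 0 "pi / 4" "- (pi / 4)"] by simp
qed

text \<open>For the directions \<open>0, \<pi>/4, -\<pi>/4, \<pi>/2\<close>, symmetric about the line of direction \<open>0\<close>, both
  terms of the concurrency relation are equal.\<close>

lemma half_zero: "w 0 (pi / 2) (pi / 4) = 0"
proof -
  let ?q = "pi / 4" and ?h = "pi / 2"
  have "sin (3 * pi / 4) \<noteq> 0"
    using sin_gt_zero[of "3 * pi / 4"] by simp
  then have ne: "sin (0 - ?q) \<noteq> 0" "sin (0 - (- ?q)) \<noteq> 0" "sin (0 - ?h) \<noteq> 0"
    "sin (?q - (- ?q)) \<noteq> 0" "sin (- ?q - ?h) \<noteq> 0" "sin (?h - ?q) \<noteq> 0"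
    using sin_minus[of "3 * pi / 4"] by (simp_all add: sin_45)
  have refl: "w 0 (- ?q) ?h = w 0 ?q ?h" "w 0 ?h (- ?q) = w 0 ?h ?q" "w 0 (- ?q) ?q = w 0 ?q (- ?q)"
    using reflect[of 0 ?q "- ?h"] period_3[of 0 ?q "- ?h"] reflect[of 0 "- ?h" ?q]
      period_2[of 0 "- ?h" ?q] reflect[of 0 ?q "- ?q"] by simp_all
  have "w 0 ?q (- ?q) * w 0 ?q ?h * w 0 ?h ?q = 0"
    using four_lines[OF ne] unfolding refl by auto
  moreover have "w 0 ?q ?h \<noteq> 0"
    by (intro quarter_nonzero) simp_all
  moreover have "w 0 ?q (- ?q) \<noteq> 0"
    using quarter_nonzero[of "3 * pi / 4"] period_3[of 0 ?q "- ?q"] by simp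
  ultimately show ?thesis by simp
qed

lemma ratio_function_zero_iff:
  assumes x: "0 < x" "x < pi" and y: "0 < y" "y < pi" and "x \<noteq> y"
  shows "ratio_function x = 0 \<longleftrightarrow> w 0 x y = 0"
proof (cases "x = pi / 4")
  case True
  then show ?thesis
    using quarter_nonzero[OF y] \<open>x \<noteq> y\<close> unfolding ratio_function_def True by simp
next
  case False
  then have "ratio_function x = 0 \<longleftrightarrow> w 0 x (pi / 4) = 0"
    using quarter_nonzero[OF x] by (simp add: ratio_function_def)
  also have "\<dots> \<longleftrightarrow> vanishes 0 x (pi / 4)"
    using vanishes_0_iff[of x "pi / 4"] x False by simp
  also have "\<dots> \<longleftrightarrow> vanishes 0 x y"
    using vanishes_persists[of 0 x _ "pi / 4"] vanishes_persists[of 0 x _ y]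
      sin_diff_nonzero_0_pi[OF x y \<open>x \<noteq> y\<close>] sin_diff_nonzero_0_pi[of x "pi / 4"] x False by auto
  also have "\<dots> \<longleftrightarrow> w 0 x y = 0"
    using vanishes_0_iff x y \<open>x \<noteq> y\<close> by simp
  finally show ?thesis .
qed

lemma ratio_function_proportion:
  assumes x: "0 < x" "x < pi" and y: "0 < y" "y < pi" and "x \<noteq> y"
  shows "ratio_function y * w 0 x y = - ratio_function x * w 0 y x"
proof -
  let ?q = "pi / 4"
  consider "x = ?q" | "y = ?q" | "x \<noteq> ?q" "y \<noteq> ?q" by blast
  then show ?thesis
  proof cases
    case 1
    then show ?thesis
      using quarter_nonzero[OF y] \<open>x \<noteq> y\<close> unfolding ratio_function_def 1 by simp
  next
    case 2
    then show ?thesis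
      using quarter_nonzero[OF x] \<open>x \<noteq> y\<close> unfolding ratio_function_def 2 by simp
  next
    case 3
    have q: "0 < ?q" "?q < pi" by simp_all
    have "w 0 ?q y * w 0 y x * w 0 x ?q + w 0 y ?q * w 0 x y * w 0 ?q x = 0"
      using sin_diff_nonzero_0_pi[OF x y \<open>x \<noteq> y\<close>] sin_diff_nonzero_0_pi[OF y x] \<open>x \<noteq> y\<close>
        sin_diff_nonzero_0_pi[OF x q 3(1)] sin_diff_nonzero_0_pi[OF q y] sin_diff_nonzero_0_pi[OF q x] 3
      by (intro four_lines) auto
    then show ?thesis
      using quarter_nonzero[OF x] quarter_nonzero[OF y] 3
      by (simp add: ratio_function_def field_simps)
  qed
qed

text \<open>Apply the proportion to \<open>x\<close> and \<open>\<pi> - x\<close>, whose weights agree by reflection.\<close>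

lemma ratio_function_odd: "odd_about_half_pi ratio_function"
  unfolding odd_about_half_pi_def
proof (intro allI impI, elim conjE)
  fix x :: real
  assume x: "0 < x" "x < pi"
  show "ratio_function (pi - x) = - ratio_function x"
  proof (cases "x = pi / 2")
    case True
    show ?thesis
      unfolding True by (simp add: ratio_function_def half_zero)
  next
    case False
    have y: "0 < pi - x" "pi - x < pi" "x \<noteq> pi - x"
      using x False by auto
    have sym: "w 0 (pi - x) x = w 0 x (pi - x)"
      using period_2[of 0 "- x" x] period_3[of 0 x "- x"] reflect[of 0 x "- x"]
      by (simp add: algebra_simps)
    show ?thesis
    proof (cases "w 0 x (pi - x) = 0")
      case True
      then show ?thesis
        using ratio_function_zero_iff[OF x y] ratio_function_zero_iff[OF y(1,2) x] y(3) sym by simp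
    next
      case False
      then show ?thesis
        using ratio_function_proportion[OF x y] unfolding sym
        by (metis mult_right_cancel)
    qed
  qed
qed

end

section \<open>The weights of a concurrent center\<close>

lemma meets_sidelines_unique:
  assumes "meets_sidelines A B C l D E F" "meets_sidelines A B C l D' E' F'"
  shows "D' = D" "E' = E" "F' = F"
  using assms unfolding meets_sidelines_def by auto

text \<open>If both weights were zero, then in a triangle cut off by a transversal the center would be the
  vertex itself, and the line joining them would not exist.\<close>

lemma direction_weight_not_both_zero:
  assumes cf: "center_function f" and def: "always_defined f"
    and s: "sin \<theta> \<noteq> 0" "sin \<eta> \<noteq> (0::real)" "sin (\<theta> - \<eta>) \<noteq> 0"
    and zero: "direction_weight f 0 \<theta> \<eta> = 0"
  shows "direction_weight f 0 \<eta> \<theta> \<noteq> 0"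
proof
  assume zero': "direction_weight f 0 \<eta> \<theta> = 0"
  \<comment> \<open>A fourth direction is needed for a transversal. Of the four directions \<open>0, 1, 2, 3\<close>, less than \<open>\<pi>\<close>
    apart, each of the three given ones excludes at most one.\<close>
  have excl: "x = y" if "0 \<le> x" "x \<le> 3" "0 \<le> y" "y \<le> 3" "sin (x - t) = 0" "sin (y - t) = 0" for x y t :: real
  proof (rule ccontr)
    assume "x \<noteq> y"
    have "sin ((x - t) - (y - t)) = 0"
      unfolding sin_diff[of "x - t"] using that(5,6) by simp
    then have "sin (x - y) = 0" by simp
    moreover have "x < y + pi" "y < x + pi"
      using that(1-4) pi_gt3 by linarith+
    ultimately show False
      using \<open>x \<noteq> y\<close> sin_diff_nonzero[of x y] sin_diff_nonzero[of y x] by linarith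
  qed
  have "\<exists>\<zeta>::real. sin (\<zeta> - 0) \<noteq> 0 \<and> sin (\<zeta> - \<theta>) \<noteq> 0 \<and> sin (\<zeta> - \<eta>) \<noteq> 0"
  proof (rule ccontr)
    assume "\<not> ?thesis"
    then have all: "sin (x - 0) = 0 \<or> sin (x - \<theta>) = 0 \<or> sin (x - \<eta>) = 0" for x :: real
      by blast
    have two: "\<not> (sin (x - t) = 0 \<and> sin (y - t) = 0)"
      if "x \<in> {0, 1, 2, 3}" "y \<in> {0, 1, 2, 3}" "x \<noteq> y" for x y t :: real
      using excl[of x y t] that by auto
    show False
      using all[of 0] all[of 1] all[of 2] all[of 3]
        two[of 0 1] two[of 0 2] two[of 0 3] two[of 1 2] two[of 1 3] two[of 2 3]
      by (simp only: insert_iff simp_thms zero_neq_one one_neq_zero) (smt (verit) zero_neq_numeral)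
  qed
  then obtain \<zeta> :: real where \<zeta>: "sin (\<zeta> - 0) \<noteq> 0" "sin (\<zeta> - \<theta>) \<noteq> 0" "sin (\<zeta> - \<eta>) \<noteq> 0"
    by blast
  have ne: "sin \<zeta> \<noteq> 0" "sin (\<eta> - \<zeta>) \<noteq> 0" "sin (\<zeta> - \<theta>) \<noteq> 0"
    using \<zeta> sin_minus[of "\<zeta> - \<eta>"] by simp_all
  obtain A B C l D E F c where
    cfg: "\<not> collinear {A, B, C}" "admissible_transversal A B C l" "meets_sidelines A B C l D E F"
    and "c > 0" and dist: "dist E C = c * \<bar>sin \<theta>\<bar>" "dist C D = c * \<bar>sin \<eta>\<bar>" "dist D E = c * \<bar>sin (\<theta> - \<eta>)\<bar>"
    using transversal_with_directions[OF s(1,2) ne(1) s(3) ne(2,3)] by metis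
  obtain \<kappa> where
    "f (c * \<bar>sin \<theta>\<bar>) (c * \<bar>sin \<eta>\<bar>) (c * \<bar>sin (\<theta> - \<eta>)\<bar>) = \<kappa> * direction_weight f 0 \<theta> \<eta>"
    "f (c * \<bar>sin \<eta>\<bar>) (c * \<bar>sin (\<theta> - \<eta>)\<bar>) (c * \<bar>sin \<theta>\<bar>) = \<kappa> * direction_weight f 0 \<eta> \<theta>"
    using direction_weight_scaled[OF cf \<open>c > 0\<close> s] by metis
  then have "f (dist E C) (dist C D) (dist D E) = 0" "f (dist C D) (dist D E) (dist E C) = 0"
    unfolding dist zero zero' by simp_all
  then have "line_to_X f C D E = 0"
    by (simp add: line_to_X_def X_point_def Let_def cross_mult_right)
  moreover have "line_to_X f C D E \<noteq> 0"
    using def cfg(1,2) meets_sidelines_unique[OF cfg(3)]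
    unfolding always_defined_def centers_defined_def by metis
  ultimately show False by simp
qed

lemma direction_weight_four_lines:
  assumes cf: "center_function f"
    and conc: "\<And>A B C l. \<not> collinear {A, B, C} \<Longrightarrow> admissible_transversal A B C l \<Longrightarrow> concurrent_for f A B C l"
    and s: "sin \<theta>1 \<noteq> 0" "sin \<theta>2 \<noteq> 0" "sin \<theta>3 \<noteq> (0::real)"
    and ds: "sin (\<theta>1 - \<theta>2) \<noteq> 0" "sin (\<theta>2 - \<theta>3) \<noteq> 0" "sin (\<theta>3 - \<theta>1) \<noteq> 0"
  defines "w \<equiv> direction_weight f"
  shows "w 0 \<theta>1 \<theta>2 * w 0 \<theta>2 \<theta>3 * w 0 \<theta>3 \<theta>1 + w 0 \<theta>2 \<theta>1 * w 0 \<theta>3 \<theta>2 * w 0 \<theta>1 \<theta>3 = 0"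
proof -
  obtain A B C l D E F a b c where
    cfg: "\<not> collinear {A, B, C}" "admissible_transversal A B C l" "meets_sidelines A B C l D E F"
    and pos: "a > 0" "b > 0" "c > 0"
    and dist: "dist F A = a * \<bar>sin \<theta>2\<bar>" "dist A E = a * \<bar>sin \<theta>3\<bar>" "dist E F = a * \<bar>sin (\<theta>2 - \<theta>3)\<bar>"
    "dist D B = b * \<bar>sin \<theta>3\<bar>" "dist B F = b * \<bar>sin \<theta>1\<bar>" "dist F D = b * \<bar>sin (\<theta>3 - \<theta>1)\<bar>"
    "dist E C = c * \<bar>sin \<theta>1\<bar>" "dist C D = c * \<bar>sin \<theta>2\<bar>" "dist D E = c * \<bar>sin (\<theta>1 - \<theta>2)\<bar>"
    by (rule transversal_with_directions[OF s ds])
  obtain p where p: "p > 0" "f (dist F A) (dist A E) (dist E F) = p * w 0 \<theta>2 \<theta>3"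
      "f (dist A E) (dist E F) (dist F A) = p * w 0 \<theta>3 \<theta>2"
    unfolding dist w_def by (rule direction_weight_scaled[OF cf pos(1) s(2,3) ds(2)])
  obtain q where q: "q > 0" "f (dist D B) (dist B F) (dist F D) = q * w 0 \<theta>3 \<theta>1"
      "f (dist B F) (dist F D) (dist D B) = q * w 0 \<theta>1 \<theta>3"
    unfolding dist w_def by (rule direction_weight_scaled[OF cf pos(2) s(3,1) ds(3)])
  obtain r where r: "r > 0" "f (dist E C) (dist C D) (dist D E) = r * w 0 \<theta>1 \<theta>2"
      "f (dist C D) (dist D E) (dist E C) = r * w 0 \<theta>2 \<theta>1"
    unfolding dist w_def by (rule direction_weight_scaled[OF cf pos(3) s(1,2) ds(1)])
  have "concurrent_lines (line_to_X f A E F) (line_to_X f B F D) (line_to_X f C D E)"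
    using conc[OF cfg(1,2)] meets_sidelines_unique[OF cfg(3)] unfolding concurrent_for_def by metis
  then have "(p * w 0 \<theta>2 \<theta>3) * (q * w 0 \<theta>3 \<theta>1) * (r * w 0 \<theta>1 \<theta>2)
      + (p * w 0 \<theta>3 \<theta>2) * (q * w 0 \<theta>1 \<theta>3) * (r * w 0 \<theta>2 \<theta>1) = 0"
    unfolding concurrent_iff_weights[OF cfg] p q r .
  then have "p * q * r * (w 0 \<theta>1 \<theta>2 * w 0 \<theta>2 \<theta>3 * w 0 \<theta>3 \<theta>1 + w 0 \<theta>2 \<theta>1 * w 0 \<theta>3 \<theta>2 * w 0 \<theta>1 \<theta>3) = 0"
    by algebra
  then show ?thesis
    using p(1) q(1) r(1) by simp
qed

lemma direction_weight_translate: "direction_weight f (i + t) (j + t) (k + t) = direction_weight f i j k"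
  by (simp add: direction_weight_def)

lemma direction_weight_nonzero_open:
  assumes stab: "stably_nonzero f"
    and ne: "sin (i - j) \<noteq> 0" "sin (j - k) \<noteq> 0" "sin (k - i) \<noteq> (0::real)"
    and "cos (i - j) \<noteq> 0" "direction_weight f i j k \<noteq> 0"
  shows "\<forall>\<^sub>F l in nhds k. direction_weight f i j l \<noteq> 0"
proof -
  let ?S = "{(x, y, z). triangle_sides x y z \<and> x\<^sup>2 \<noteq> y\<^sup>2 + z\<^sup>2 \<and> f x y z \<noteq> 0}"
  let ?g = "\<lambda>l. (\<bar>sin (i - j)\<bar>, \<bar>sin (j - l)\<bar>, \<bar>sin (l - i)\<bar>)"
  \<comment> \<open>The law of cosines: the triangle has a right angle opposite its first side only if \<open>i\<close> and \<open>j\<close>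
    are perpendicular.\<close>
  have cosine_law: "(sin (x + y))\<^sup>2 = (sin x)\<^sup>2 + (sin y)\<^sup>2 + 2 * sin x * sin y * cos (x + y)" for x y :: real
  proof -
    have "(sin x)\<^sup>2 + (cos x)\<^sup>2 = 1" "(sin y)\<^sup>2 + (cos y)\<^sup>2 = 1" by simp_all
    then show ?thesis
      unfolding sin_add cos_add by algebra
  qed
  have "sin (i - j) = - sin ((j - k) + (k - i))" "cos (i - j) = cos ((j - k) + (k - i))"
    using sin_minus[of "i - j"] cos_minus[of "i - j"] by simp_all
  then have "(sin (i - j))\<^sup>2 = (sin (j - k))\<^sup>2 + (sin (k - i))\<^sup>2 + 2 * sin (j - k) * sin (k - i) * cos (i - j)"
    using cosine_law[of "j - k" "k - i"] by simp
  then have "(sin (i - j))\<^sup>2 \<noteq> (sin (j - k))\<^sup>2 + (sin (k - i))\<^sup>2"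
    using assms by simp
  then have "?g k \<in> ?S"
    using triangle_sides_abs_sin[OF ne] assms(6) by (simp add: direction_weight_def)
  moreover have "open (?g -` ?S)"
    using stab unfolding stably_nonzero_def by (intro open_vimage) (auto intro!: continuous_intros)
  ultimately have "\<forall>\<^sub>F l in nhds k. l \<in> ?g -` ?S"
    by (intro eventually_nhds_in_open) auto
  then show ?thesis
    by eventually_elim (simp add: direction_weight_def)
qed

lemma four_line_weights_direction_weight:
  assumes cf: "center_function f" and def: "always_defined f" and stab: "stably_nonzero f"
    and conc: "\<And>A B C l. \<not> collinear {A, B, C} \<Longrightarrow> admissible_transversal A B C l \<Longrightarrow> concurrent_for f A B C l"
  shows "four_line_weights (direction_weight f)"
proof
  fix i j k l :: real
  let ?w = "direction_weight f"
  have neg: "sin (b - a) = - sin (a - b)" for a b :: real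
    using sin_minus[of "a - b"] by simp
  have to_0: "?w i a b = ?w 0 (a - i) (b - i)" for a b
    using direction_weight_translate[of f 0 i "a - i" "b - i"] by simp
  show "?w i j k = ?w j i k" if "sin (i - j) \<noteq> 0" "sin (j - k) \<noteq> 0" "sin (k - i) \<noteq> 0"
    unfolding direction_weight_def neg[of j i] neg[of k j] neg[of i k] abs_minus_cancel
    by (rule center_function_symmetric[OF cf triangle_sides_abs_sin[OF that]])
  show "?w (i + t) (j + t) (k + t) = ?w i j k" for t
    by (rule direction_weight_translate)
  show "?w (- i) (- j) (- k) = ?w i j k"
    unfolding direction_weight_def using neg[of i j] neg[of j k] neg[of k i] by simp
  have "sin (i - (j + pi)) = - sin (i - j)" "sin ((j + pi) - k) = - sin (j - k)"
    "sin (j - (k + pi)) = - sin (j - k)" "sin ((k + pi) - i) = - sin (k - i)"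
    using sin_minus_pi[of "i - j"] sin_periodic_pi[of "j - k"] sin_minus_pi[of "j - k"] sin_periodic_pi[of "k - i"]
    by (simp_all add: algebra_simps)
  then show "?w i (j + pi) k = ?w i j k" "?w i j (k + pi) = ?w i j k"
    by (simp_all add: direction_weight_def)
  show "?w i k j \<noteq> 0" if "sin (i - j) \<noteq> 0" "sin (j - k) \<noteq> 0" "sin (k - i) \<noteq> 0" "?w i j k = 0"
    unfolding to_0[of k j] using that neg[of i j]
    by (intro direction_weight_not_both_zero[OF cf def]) (simp_all flip: to_0)
  show "?w i j k * ?w i k l * ?w i l j + ?w i k j * ?w i l k * ?w i j l = 0"
    if "sin (i - j) \<noteq> 0" "sin (i - k) \<noteq> 0" "sin (i - l) \<noteq> 0" "sin (j - k) \<noteq> 0" "sin (k - l) \<noteq> 0" "sin (l - j) \<noteq> 0"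
    unfolding to_0 using that neg[of i j] neg[of i k] neg[of i l]
    by (intro direction_weight_four_lines[OF cf conc]) simp_all
  show "\<forall>\<^sub>F l in nhds k. ?w i j l \<noteq> 0" if "sin (i - j) \<noteq> 0" "sin (j - k) \<noteq> 0" "sin (k - i) \<noteq> 0"
      "cos (i - j) \<noteq> 0" "?w i j k \<noteq> 0"
    using direction_weight_nonzero_open[OF stab that] .
qed

lemma shape_function_swap:
  assumes "center_function f" "shape \<alpha> \<beta> \<gamma>"
  shows "shape_function f \<alpha> \<gamma> \<beta> = shape_function f \<alpha> \<beta> \<gamma>"
  unfolding shape_function_def
  using center_function_symmetric[OF assms(1) triangle_sides_sin[OF assms(2)]] by simp

section \<open>The leg-swap ratio and the factorization\<close>

text \<open>The lines of directions \<open>0\<close>, \<open>\<alpha>\<close> and \<open>\<pi> - \<beta>\<close> form a triangle of shape \<open>(\<alpha>, \<beta>, \<gamma>)\<close> with the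
  angles \<open>\<alpha>\<close> and \<open>\<beta>\<close> on the first line.\<close>

lemma leg_swap_ratio_if_concurrent:
  assumes cf: "center_function f" and def: "always_defined f" and stab: "stably_nonzero f"
    and conc: "\<And>A B C l. \<not> collinear {A, B, C} \<Longrightarrow> admissible_transversal A B C l \<Longrightarrow> concurrent_for f A B C l"
  shows "\<exists>\<phi>. odd_about_half_pi \<phi> \<and> (\<forall>\<alpha> \<beta> \<gamma>. shape \<alpha> \<beta> \<gamma> \<and> shape_function f \<alpha> \<beta> \<gamma> \<noteq> 0
    \<longrightarrow> \<phi> \<alpha> \<noteq> 0 \<and> leg_swap_ratio f \<alpha> \<beta> \<gamma> = \<phi> \<beta> / \<phi> \<alpha>)"
proof -
  let ?w = "direction_weight f"
  interpret four_line_weights ?w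
    by (rule four_line_weights_direction_weight[OF assms])
  have "ratio_function \<alpha> \<noteq> 0 \<and> leg_swap_ratio f \<alpha> \<beta> \<gamma> = ratio_function \<beta> / ratio_function \<alpha>"
    if sh: "shape \<alpha> \<beta> \<gamma>" and nz: "shape_function f \<alpha> \<beta> \<gamma> \<noteq> 0" for \<alpha> \<beta> \<gamma>
  proof -
    have a: "0 < \<alpha>" "\<alpha> < pi" and b: "0 < pi - \<beta>" "pi - \<beta> < pi" and ne: "\<alpha> \<noteq> pi - \<beta>"
      and \<beta>: "0 < \<beta>" "\<beta> < pi" and sum: "\<alpha> - (pi - \<beta>) = - \<gamma>" "pi - \<beta> - \<alpha> = \<gamma>"
      using sh unfolding shape_def by auto
    have pos: "sin \<alpha> > 0" "sin \<beta> > 0" "sin \<gamma> > 0"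
      using sh unfolding shape_def by (auto intro: sin_gt_zero)
    have "?w 0 \<alpha> (pi - \<beta>) = shape_function f \<alpha> \<gamma> \<beta>"
      unfolding direction_weight_def shape_function_def sum using pos by simp
    then have w1: "?w 0 \<alpha> (pi - \<beta>) = shape_function f \<alpha> \<beta> \<gamma>"
      using shape_function_swap[OF cf sh] by simp
    have "?w 0 (pi - \<beta>) \<alpha> = shape_function f \<beta> \<gamma> \<alpha>"
      unfolding direction_weight_def shape_function_def sum using pos sin_minus[of "pi - \<beta>"] by simp
    then have w2: "?w 0 (pi - \<beta>) \<alpha> = shape_function f \<beta> \<alpha> \<gamma>"
      using shape_function_swap[OF cf shape_rotate[OF sh]] by simp
    have "ratio_function \<alpha> \<noteq> 0"
      using ratio_function_zero_iff[OF a b ne] nz w1 by simp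
    moreover have "ratio_function (pi - \<beta>) = - ratio_function \<beta>"
      using ratio_function_odd \<beta> unfolding odd_about_half_pi_def by blast
    then have "ratio_function \<beta> * shape_function f \<alpha> \<beta> \<gamma> = ratio_function \<alpha> * shape_function f \<beta> \<alpha> \<gamma>"
      using ratio_function_proportion[OF a b ne] unfolding w1 w2 by simp
    ultimately show ?thesis
      using nz by (simp add: leg_swap_ratio_def field_simps)
  qed
  then show ?thesis
    using ratio_function_odd by blast
qed

lemma factorization_if_leg_swap_ratio:
  assumes cf: "center_function f"
    and ratio: "\<And>\<alpha> \<beta> \<gamma>. shape \<alpha> \<beta> \<gamma> \<Longrightarrow> shape_function f \<alpha> \<beta> \<gamma> \<noteq> 0 \<Longrightarrow>
      \<phi> \<alpha> \<noteq> 0 \<and> leg_swap_ratio f \<alpha> \<beta> \<gamma> = \<phi> \<beta> / \<phi> \<alpha>"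
  shows "\<exists>M. fully_symmetric M \<and> (\<forall>\<alpha> \<beta> \<gamma>. shape \<alpha> \<beta> \<gamma> \<longrightarrow> shape_function f \<alpha> \<beta> \<gamma> = \<phi> \<alpha> * M \<alpha> \<beta> \<gamma>)"
proof -
  let ?F = "shape_function f"
  have swap: "?F \<beta> \<alpha> \<gamma> * \<phi> \<alpha> = ?F \<alpha> \<beta> \<gamma> * \<phi> \<beta>"
    if "shape \<alpha> \<beta> \<gamma>" "?F \<alpha> \<beta> \<gamma> \<noteq> 0" for \<alpha> \<beta> \<gamma>
    using ratio[OF that] that(2) by (simp add: leg_swap_ratio_def field_simps)
  \<comment> \<open>The three weights of a shape are proportional to the values of \<open>\<phi>\<close>; the default \<open>0\<close> covers the
    shapes in which all three weights vanish.\<close>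
  define M where "M \<alpha> \<beta> \<gamma> =
    (if ?F \<alpha> \<beta> \<gamma> \<noteq> 0 then ?F \<alpha> \<beta> \<gamma> / \<phi> \<alpha>
     else if ?F \<beta> \<gamma> \<alpha> \<noteq> 0 then ?F \<beta> \<gamma> \<alpha> / \<phi> \<beta>
     else if ?F \<gamma> \<alpha> \<beta> \<noteq> 0 then ?F \<gamma> \<alpha> \<beta> / \<phi> \<gamma> else 0)" for \<alpha> \<beta> \<gamma>
  have sym: "M \<beta> \<alpha> \<gamma> = M \<alpha> \<beta> \<gamma>" "M \<alpha> \<gamma> \<beta> = M \<alpha> \<beta> \<gamma>" and fac: "?F \<alpha> \<beta> \<gamma> = \<phi> \<alpha> * M \<alpha> \<beta> \<gamma>"
    if sh: "shape \<alpha> \<beta> \<gamma>" for \<alpha> \<beta> \<gamma>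
  proof -
    have sh': "shape \<beta> \<gamma> \<alpha>" "shape \<gamma> \<alpha> \<beta>" "shape \<beta> \<alpha> \<gamma>" "shape \<alpha> \<gamma> \<beta>" "shape \<gamma> \<beta> \<alpha>"
      using sh by (auto simp: shape_def)
    have F: "?F \<alpha> \<gamma> \<beta> = ?F \<alpha> \<beta> \<gamma>" "?F \<beta> \<alpha> \<gamma> = ?F \<beta> \<gamma> \<alpha>" "?F \<gamma> \<beta> \<alpha> = ?F \<gamma> \<alpha> \<beta>"
      using sh sh'(1,2) shape_function_swap[OF cf] by blast+
    obtain m where m: "?F \<alpha> \<beta> \<gamma> = \<phi> \<alpha> * m" "?F \<beta> \<gamma> \<alpha> = \<phi> \<beta> * m" "?F \<gamma> \<alpha> \<beta> = \<phi> \<gamma> * m"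
    proof -
      consider "?F \<alpha> \<beta> \<gamma> \<noteq> 0" | "?F \<beta> \<gamma> \<alpha> \<noteq> 0" | "?F \<gamma> \<alpha> \<beta> \<noteq> 0"
        | "?F \<alpha> \<beta> \<gamma> = 0" "?F \<beta> \<gamma> \<alpha> = 0" "?F \<gamma> \<alpha> \<beta> = 0" by blast
      then show thesis
      proof cases
        case 1
        then show ?thesis
          using that[of "?F \<alpha> \<beta> \<gamma> / \<phi> \<alpha>"] swap[OF sh] swap[OF sh'(4)] ratio[OF sh] F
          by (simp add: field_simps)
      next
        case 2
        then show ?thesis
          using that[of "?F \<beta> \<gamma> \<alpha> / \<phi> \<beta>"] swap[OF sh'(3)] swap[OF sh'(1)] ratio[OF sh'(1)] F
          by (simp add: field_simps)
      next
        case 3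
        then show ?thesis
          using that[of "?F \<gamma> \<alpha> \<beta> / \<phi> \<gamma>"] swap[OF sh'(2)] swap[OF sh'(5)] ratio[OF sh'(2)] F
          by (simp add: field_simps)
      next
        case 4
        then show ?thesis
          using that[of 0] by simp
      qed
    qed
    then show "?F \<alpha> \<beta> \<gamma> = \<phi> \<alpha> * M \<alpha> \<beta> \<gamma>" "M \<beta> \<alpha> \<gamma> = M \<alpha> \<beta> \<gamma>" "M \<alpha> \<gamma> \<beta> = M \<alpha> \<beta> \<gamma>"
      using F by (auto simp: M_def)
  qed
  have "fully_symmetric M"
    unfolding fully_symmetric_def
    using sym shape_rotate shape_swap by metis
  then show ?thesis
    using fac by blast
qed

theorem theorem7p3:
  fixes f :: "real \<Rightarrow> real \<Rightarrow> real \<Rightarrow> real"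
  assumes "center_function f"
    and "always_defined f"
    and "stably_nonzero f"
  shows "((\<forall>A B C l. \<not> collinear {A, B, C} \<and> admissible_transversal A B C l
             \<longrightarrow> concurrent_for f A B C l)
          \<longleftrightarrow> (\<exists>\<phi> M. odd_about_half_pi \<phi> \<and> fully_symmetric M \<and>
                (\<forall>\<alpha> \<beta> \<gamma>. shape \<alpha> \<beta> \<gamma> \<longrightarrow> shape_function f \<alpha> \<beta> \<gamma> = \<phi> \<alpha> * M \<alpha> \<beta> \<gamma>)))
       \<and> ((\<exists>\<phi> M. odd_about_half_pi \<phi> \<and> fully_symmetric M \<and>
                (\<forall>\<alpha> \<beta> \<gamma>. shape \<alpha> \<beta> \<gamma> \<longrightarrow> shape_function f \<alpha> \<beta> \<gamma> = \<phi> \<alpha> * M \<alpha> \<beta> \<gamma>))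
          \<longleftrightarrow> (\<exists>\<phi>. odd_about_half_pi \<phi> \<and>
                (\<forall>\<alpha> \<beta> \<gamma>. shape \<alpha> \<beta> \<gamma> \<and> shape_function f \<alpha> \<beta> \<gamma> \<noteq> 0
                   \<longrightarrow> \<phi> \<alpha> \<noteq> 0 \<and> leg_swap_ratio f \<alpha> \<beta> \<gamma> = \<phi> \<beta> / \<phi> \<alpha>)))"
  (is "(?conc \<longleftrightarrow> ?fac) \<and> (?fac \<longleftrightarrow> ?ratio)")
proof -
  have "?ratio" if ?conc
    using leg_swap_ratio_if_concurrent[OF assms] that by blast
  moreover have "?fac" if ?ratio
    using factorization_if_leg_swap_ratio[OF assms(1)] that by metis
  moreover have "?conc" if ?fac
  proof (intro allI impI, elim conjE)
    fix A B C l
    assume tri: "\<not> collinear {A, B, C}" and adm: "admissible_transversal A B C l"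
    have "centers_defined f A B C l"
      using assms(2) tri adm unfolding always_defined_def by blast
    moreover from this obtain D E F where "meets_sidelines A B C l D E F"
      unfolding centers_defined_def by blast
    ultimately show "concurrent_for f A B C l"
      using that concurrent_if_factorization[OF assms(1) _ _ _ tri adm]
      unfolding concurrent_for_def by metis
  qed
  moreover have "?ratio" if ?fac
    using \<open>?fac \<Longrightarrow> ?conc\<close> \<open>?conc \<Longrightarrow> ?ratio\<close> that by blast
  ultimately show ?thesis
    by blast
qed

end
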